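(* Let $\sigma>0$, $t\ge1$, $p\ge 1$, let $\boldsymbol y_i=\boldsymbol x_i+\boldsymbol\epsilon_i\in\mathbb{R}^p$ ($1\le i\le n$) with $\boldsymbol\epsilon_1,\dots,\boldsymbol\epsilon_n$ i.i.d. $N(\mathbf 0,\sigma^2\mathbf I_{p\times p})$, where $(\boldsymbol x_i)_{i=1}^n$ is constant on each of the $K$ intervals $\{n_k,\dots,n_{k+1}-1\}$, $1\le k\le K$, and let $(\hat{\boldsymbol x}_i)_{i=1}^n$ be the minimizer of $$\sum_{i=1}^n\|\boldsymbol y_i-\boldsymbol x_i\|^2+\lambda\sum_{i=1}^{n-1}\|\boldsymbol x_i-\boldsymbol x_{i+1}\|$$ over $(\mathbb{R}^p)^n$. Let $m_k=n_{k+1}-n_k$; for $1\le i\le n$ let $k(i)$ be the index with $n_{k(i)}\le i\le n_{k(i)+1}-1$, and let $d_i=\min(i+1-n_{k(i)},\,n_{k(i)+1}-i)$. Let $M_y=\sigma\max\left(\sqrt{8(\log n+\log t)+p},\,2\sqrt p\right)$ and assume $25^2M_y\le\lambda<\min_{1\le k\le K}(7m_k-\sqrt{m_k})M_y$. Then with probability at least $1-1/t^2$, for all $1\le i\le n$, $$\|\hat{\boldsymbol x}_i-\boldsymbol x_i\|\le\max\left(\frac{4\left(M_y\sqrt{m_{k(i)}/2}+\lambda\right)}{m_{k(i)}},\ \frac{50M_y}{\sqrt{m_{k(i)}}},\ \frac{25\sqrt5\,M_y}{\sqrt{d_i}},\ 125\sqrt{\frac{M_y^3}{\lambda}}\right)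.$$
   Context: The true signal $(\boldsymbol x_i)_{i=1}^n$ in $\mathbb{R}^p$ is deterministic and piecewise constant with $K$ pieces: there are integers $1=n_1<n_2<\dots<n_K<n$, with $n_{K+1}=n+1$, such that $\boldsymbol x_{n_k}=\boldsymbol x_{n_k+1}=\dots=\boldsymbol x_{n_{k+1}-1}$ for each $1\le k\le K$. $\|\cdot\|$ is the Euclidean norm. In the optimization problem the symbols $\boldsymbol x_i$ denote the optimization variables; in the bound $\boldsymbol x_i$ denotes the true signal. The objective is strictly convex, so the minimizer is unique. *)

theory Defs
  imports "HOL-Probability.Probability"
begin

(* Lebesgue density of N(mu, sigma^2 I) on R^p, with p = CARD('p). *)
definition isotropic_normal_density :: "real ^ 'p \<Rightarrow> real \<Rightarrow> real ^ 'p \<Rightarrow> real" where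
  "isotropic_normal_density \<mu> \<sigma> v =
     exp (- (norm (v - \<mu>))\<^sup>2 / (2 * \<sigma>\<^sup>2)) / (2 * pi * \<sigma>\<^sup>2) powr (real CARD('p) / 2)"

definition tv_objective :: "nat \<Rightarrow> real \<Rightarrow> (nat \<Rightarrow> real ^ 'p) \<Rightarrow> (nat \<Rightarrow> real ^ 'p) \<Rightarrow> real" where
  "tv_objective n lam y z =
     (\<Sum>i=1..n. (norm (y i - z i))\<^sup>2) + lam * (\<Sum>i=1..n-1. norm (z i - z (i+1)))"

(* (R^p)^n is represented by the functions that are undefined outside {1..n}, so that a
   minimizer is unique as a function. *)
definition is_tv_minimizer :: "nat \<Rightarrow> real \<Rightarrow> (nat \<Rightarrow> real ^ 'p) \<Rightarrow> (nat \<Rightarrow> real ^ 'p) \<Rightarrow> bool" where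
  "is_tv_minimizer n lam y z \<longleftrightarrow>
     is_arg_min (tv_objective n lam y) (\<lambda>w. w \<in> {1..n} \<rightarrow>\<^sub>E UNIV) z"

(* nn k is the first index of the k-th piece; the last start must be strictly below n, and
   nn (K + 1) = n + 1 closes the last piece. *)
definition breakpoints :: "nat \<Rightarrow> nat \<Rightarrow> (nat \<Rightarrow> nat) \<Rightarrow> bool" where
  "breakpoints n K nn \<longleftrightarrow>
     1 \<le> K \<and> nn 1 = 1 \<and> strict_mono_on {1..K} nn \<and> nn K < n \<and> nn (K + 1) = n + 1"

definition piecewise_constant :: "nat \<Rightarrow> (nat \<Rightarrow> nat) \<Rightarrow> (nat \<Rightarrow> real ^ 'p) \<Rightarrow> bool" where
  "piecewise_constant K nn x \<longleftrightarrow>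
     (\<forall>k\<in>{1..K}. \<forall>i\<in>{nn k..<nn (k+1)}. x i = x (nn k))"

definition piece_length :: "(nat \<Rightarrow> nat) \<Rightarrow> nat \<Rightarrow> nat" where
  "piece_length nn k = nn (k+1) - nn k"

definition piece_of :: "nat \<Rightarrow> (nat \<Rightarrow> nat) \<Rightarrow> nat \<Rightarrow> nat" where
  "piece_of K nn i = (THE k. k \<in> {1..K} \<and> nn k \<le> i \<and> i \<le> nn (k+1) - 1)"

definition boundary_dist :: "nat \<Rightarrow> (nat \<Rightarrow> nat) \<Rightarrow> nat \<Rightarrow> nat" where
  "boundary_dist K nn i =
     min (i + 1 - nn (piece_of K nn i)) (nn (piece_of K nn i + 1) - i)"

definition noise_level :: "real \<Rightarrow> nat \<Rightarrow> real \<Rightarrow> nat \<Rightarrow> real" where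
  "noise_level \<sigma> n t p =
     \<sigma> * max (sqrt (8 * (ln (real n) + ln t) + real p)) (2 * sqrt (real p))"

definition error_bound :: "real \<Rightarrow> real \<Rightarrow> real \<Rightarrow> real \<Rightarrow> real" where
  "error_bound My lam m d =
     Max {4 * (My * sqrt (m / 2) + lam) / m,
          50 * My / sqrt m,
          25 * sqrt 5 * My / sqrt d,
          125 * sqrt (My ^ 3 / lam)}"

end

theory Submission
  imports Defs
begin

text \<open>
  Subtract the true value from the minimizer on one constant piece and call the result \<open>z\<close>.
  Optimality provides dual vectors \<open>u\<close> in the unit ball with
  \<open>(\<lambda> / 2) (u\<^sub>j\<^sub>-\<^sub>1 - u\<^sub>j) = z\<^sub>j - \<epsilon>\<^sub>j\<close>, and wherever \<open>z\<close> jumps, \<open>u\<^sub>j\<close> is the unit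
  vector along \<open>z\<^sub>j - z\<^sub>j\<^sub>+\<^sub>1\<close>.  Two facts drive the proof.

  \<^item> A Gaussian exponential-moment bound and a union bound give, with probability at least
    \<open>1 - 1 / t\<^sup>2\<close>, that every window of \<open>l\<close> consecutive noise vectors has a sum of norm at most
    \<open>M\<^sub>y \<surd>l\<close> (lemma \<open>noise_partial_sums\<close>).  Everything else is deterministic on that event.

  \<^item> At a jump, \<open>u\<^sub>j\<close> sits on the unit sphere.  Since \<open>u\<close> must stay inside the ball on both sides,
    the sums of \<open>z\<close> over windows to the left cannot have a large positive component along \<open>u\<^sub>j\<close>,
    and those to the right cannot have a large negative one; but the jump moves \<open>z\<close> in the direction
    \<open>- u\<^sub>j\<close>.  Hence jumps that lie far enough from the ends of the piece for such windows to fit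
    are negligible (lemma \<open>outward_window\<close>).

  Suppose \<open>r = \<parallel>z\<^sub>i\<parallel>\<close> exceeds the bound.  The length scale of the problem is
  \<open>l = \<lceil>100 M\<^sub>y\<^sup>2 / r\<^sup>2\<rceil>\<close>: over \<open>l\<close> or more steps a signal of size \<open>r\<close> dominates the noise by a
  factor ten, and over \<open>l\<close> steps \<open>u\<close> turns only by a bounded amount, which is where the bounds
  involving \<open>\<lambda>\<close> enter (lemma \<open>exit_scale\<close>).  Let \<open>J\<close> be the maximal run of indices
  around \<open>i\<close> with \<open>\<parallel>z\<^sub>j - z\<^sub>i\<parallel> \<le> r / 2\<close>.

  If \<open>J\<close> covers at least half of the piece, then \<open>\<parallel>\<Sum>\<^sub>J z\<parallel> \<ge> r |J| / 2\<close>, while the summed optimality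
  equation bounds it by \<open>M\<^sub>y \<surd>|J| + \<lambda>\<close>, contradicting the first term of the bound.
  Otherwise \<open>z\<close> leaves the ball of radius \<open>r / 2\<close> on a side where more than a quarter of the piece is
  left.  There, windows of length \<open>l\<close> fit on both sides of every jump between \<open>i\<close> and the exit: on one
  side because of the boundary distance of \<open>i\<close>, on the other because of the remaining quarter.
  All these jumps turn out to be nearly parallel, because a long run with \<open>z \<approx> z\<^sub>i\<close> would
  move \<open>u\<close> away from the sphere by a large and almost tangential step, hence out of the ball.
  So their total length is comparable to the displacement along a single direction,
  which the window estimates bound by less than \<open>r / 2\<close> (lemma \<open>exit_right_impossible\<close>).

  The event in the theorem is measurable because the minimizer depends on the data in a Lipschitz way
  (lemma \<open>tv_minimizer_borel_measurable\<close>).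
\<close>

section \<open>Dual vectors on a constant piece\<close>

text \<open>
  The only trace of the noise is the error allowed in the third clause, the stationarity condition summed
  over a window.  Index \<open>0\<close> of \<open>u\<close> and index \<open>m\<close> of \<open>u\<close> are the dual vectors at the two ends of the
  piece, about which nothing but the norm bound is known.
\<close>

definition tv_flow :: "nat \<Rightarrow> real \<Rightarrow> real \<Rightarrow> (nat \<Rightarrow> 'v::real_inner) \<Rightarrow> (nat \<Rightarrow> 'v) \<Rightarrow> bool" where
  "tv_flow m lam C z u \<longleftrightarrow>
     (\<forall>j\<le>m. norm (u j) \<le> 1) \<and>
     (\<forall>j\<in>{1..<m}. z j - z (Suc j) = norm (z j - z (Suc j)) *\<^sub>R u j) \<and>
     (\<forall>a b. a \<le> b \<longrightarrow> b \<le> m \<longrightarrow>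
        norm ((\<Sum>j\<in>{a<..b}. z j) - (lam / 2) *\<^sub>R (u a - u b)) \<le> C * sqrt (real (b - a)))"

lemma tv_flowD:
  assumes "tv_flow m lam C z u"
  shows "j \<le> m \<Longrightarrow> norm (u j) \<le> 1"
    and "1 \<le> j \<Longrightarrow> j < m \<Longrightarrow> z j - z (Suc j) = norm (z j - z (Suc j)) *\<^sub>R u j"
    and "a \<le> b \<Longrightarrow> b \<le> m \<Longrightarrow>
      norm ((\<Sum>j\<in>{a<..b}. z j) - (lam / 2) *\<^sub>R (u a - u b)) \<le> C * sqrt (real (b - a))"
  using assms unfolding tv_flow_def by auto

text \<open>
  Reversal of the index order turns statements about one side of an index into statements about the
  other.  Jumps change sign under it, hence so does \<open>u\<close>; there are \<open>m + 1\<close> dual vectors but only \<open>m\<close>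
  values, which explains the different index shifts.
\<close>

lemma tv_flow_reflect:
  assumes "tv_flow m lam C z u"
  shows "tv_flow m lam C (\<lambda>j. z (m + 1 - j)) (\<lambda>j. - u (m - j))"
  unfolding tv_flow_def
proof (intro conjI allI impI ballI)
  fix j assume "j \<le> m" then show "norm (- u (m - j)) \<le> 1"
    using tv_flowD(1)[OF assms, of "m - j"] by simp
next
  fix j assume j: "j \<in> {1..<m}"
  have S: "Suc (m - j) = m + 1 - j" "m + 1 - Suc j = m - j" using j by auto
  have "z (m - j) - z (m + 1 - j) = norm (z (m - j) - z (m + 1 - j)) *\<^sub>R u (m - j)"
    using tv_flowD(2)[OF assms, of "m - j"] j S by auto
  then show "z (m + 1 - j) - z (m + 1 - Suc j)
      = norm (z (m + 1 - j) - z (m + 1 - Suc j)) *\<^sub>R - u (m - j)"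
    unfolding S(2) by (metis minus_diff_eq norm_minus_commute scaleR_minus_right)
next
  fix a b assume ab: "a \<le> b" "b \<le> m"
  have sum: "(\<Sum>j\<in>{a<..b}. z (m + 1 - j)) = (\<Sum>j\<in>{m-b<..m-a}. z j)"
    by (rule sum.reindex_bij_witness[of _ "\<lambda>j. m + 1 - j" "\<lambda>j. m + 1 - j"]) (use ab in auto)
  have "(m - a) - (m - b) = b - a" using ab by auto
  then show "norm ((\<Sum>j\<in>{a<..b}. z (m + 1 - j)) - (lam / 2) *\<^sub>R (- u (m - a) - - u (m - b)))
      \<le> C * sqrt (real (b - a))"
    using tv_flowD(3)[OF assms, of "m - b" "m - a"] ab unfolding sum by simp
qed

lemma unit_at_jump:
  assumes "tv_flow m lam C z u" "1 \<le> j" "j < m" "z (Suc j) \<noteq> z j"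
  shows "norm (u j) = 1"
proof -
  have "norm (z j - z (Suc j)) = norm (z j - z (Suc j)) * norm (u j)"
    using arg_cong[OF tv_flowD(2)[OF assms(1-3)], of norm] by simp
  then show ?thesis using assms(4) by simp
qed

lemma near_unit_half:
  fixes e :: "'v::real_inner"
  assumes "norm e = 1" "norm (v - e) \<le> 1" "norm v = 1"
  shows "1 / 2 \<le> e \<bullet> v"
proof -
  have "(norm (v - e))\<^sup>2 \<le> 1" using assms(2) by (simp add: power_le_one)
  moreover have "(norm (v - e))\<^sup>2 = (norm v)\<^sup>2 - 2 * (e \<bullet> v) + (norm e)\<^sup>2"
    by (simp add: power2_norm_eq_inner inner_diff inner_commute)
  ultimately show ?thesis using assms by simp
qed

lemma inner_ge_of_near:
  fixes v w :: "'v::real_inner"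
  assumes "norm (w - v) \<le> norm v / 2"
  shows "(norm v)\<^sup>2 / 2 \<le> w \<bullet> v"
proof -
  have "\<bar>(w - v) \<bullet> v\<bar> \<le> norm (w - v) * norm v" by (rule Cauchy_Schwarz_ineq2)
  also have "\<dots> \<le> norm v / 2 * norm v" using assms by (intro mult_right_mono) auto
  finally have "- (norm v / 2 * norm v) \<le> (w - v) \<bullet> v" by linarith
  then show ?thesis by (simp add: inner_diff power2_norm_eq_inner[symmetric] power2_eq_square)
qed

text \<open>
  If all dual vectors on a stretch are within \<open>60\<close> degrees of \<open>e\<close>, every jump there loses at least half of
  its length along \<open>e\<close>.  Consequently \<open>z\<close> is monotone along \<open>e\<close>, and motion across \<open>e\<close> is paid for
  by motion along \<open>e\<close>.
\<close>

lemma aligned_drop: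
  assumes fl: "tv_flow m lam C z u" and e: "norm e = 1"
    and ac: "a \<le> c" and a1: "1 \<le> a" and cm: "c \<le> m"
    and al: "\<And>k. a \<le> k \<Longrightarrow> k < c \<Longrightarrow> norm (u k - e) \<le> 1"
  shows "norm (z a - z c) \<le> 2 * (e \<bullet> (z a - z c))"
  using ac cm al
proof (induction c rule: dec_induct)
  case base
  then show ?case by simp
next
  case (step c)
  let ?s = "norm (z c - z (Suc c))"
  have st: "z c - z (Suc c) = ?s *\<^sub>R u c"
    using tv_flowD(2)[OF fl, of c] step a1 by auto
  have "?s \<le> 2 * (e \<bullet> (z c - z (Suc c)))"
  proof (cases "?s = 0")
    case False
    then have "norm (u c) = 1" using unit_at_jump[OF fl, of c] step a1 by auto
    then have "1 / 2 \<le> e \<bullet> u c"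
      using near_unit_half[OF e, of "u c"] step.prems(2)[of c] step.hyps by auto
    then have "?s * (1 / 2) \<le> ?s * (e \<bullet> u c)" by (intro mult_left_mono) auto
    also have "\<dots> = e \<bullet> (z c - z (Suc c))" by (subst (2) st) simp
    finally show ?thesis by simp
  qed simp
  moreover have "norm (z a - z c) \<le> 2 * (e \<bullet> (z a - z c))"
    using step by auto
  moreover have "norm (z a - z (Suc c)) \<le> norm (z a - z c) + ?s"
    using norm_triangle_ineq[of "z a - z c" "z c - z (Suc c)"] by simp
  ultimately show ?case by (simp add: inner_diff algebra_simps)
qed

text \<open>
  Let \<open>e\<close> be the unit vector \<open>u b\<close>.  The dual vector reached after \<open>l\<close> steps has component at most \<open>1\<close>
  along \<open>e\<close>, so \<open>e \<bullet> (\<Sum> z)\<close> over the window is at least \<open>- C \<surd>l\<close>.  The first value of the window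
  inherits the average bound because \<open>z\<close> decreases along \<open>e\<close>.  This monotonicity needs \<open>u\<close> to stay close
  to \<open>e\<close> on the window, for which the smallness condition is made: the same lower bound on the sum limits how
  far \<open>z\<close> can have moved along \<open>e\<close>, hence, by \<open>aligned_drop\<close>, how large it can be, hence how far \<open>u\<close>
  can turn in the next step.
  
  The base point \<open>\<zeta>\<close> is \<open>z b\<close> when the jump at \<open>b\<close> itself is to be included, and \<open>z (Suc b)\<close> (with
  \<open>s = 0\<close>) when it is not; the reflected use is of the second kind.
\<close>

lemma outward_window:
  fixes z u :: "nat \<Rightarrow> 'v::real_inner"
  assumes fl: "tv_flow m lam C z u" and lam: "0 < lam" and C: "0 \<le> C"
    and l: "1 \<le> l" "b + l \<le> m" and ub: "norm (u b) = 1"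
    and jump: "\<zeta> - z (Suc b) = s *\<^sub>R u b" "0 \<le> s" and zR: "norm \<zeta> \<le> R"
    and small: "6 * (real l * R + C * sqrt (real l)) \<le> lam"
  shows "- (C / sqrt (real l)) \<le> u b \<bullet> z (Suc b)"
proof -
  let ?e = "u b"
  have R: "0 \<le> R" using zR norm_ge_zero order_trans by blast
  have drop: "norm (\<zeta> - z (b + j)) \<le> 2 * (?e \<bullet> (\<zeta> - z (b + j)))"
    if "1 \<le> j" "b + j \<le> m" and al: "\<And>k. k < j \<Longrightarrow> norm (u (b + k) - ?e) \<le> 1" for j
  proof -
    have "norm (z (Suc b) - z (b + j)) \<le> 2 * (?e \<bullet> (z (Suc b) - z (b + j)))"
    proof (rule aligned_drop[OF fl ub])
      fix k assume k: "Suc b \<le> k" "k < b + j"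
      have "k = b + (k - b)" "k - b < j" using k by auto
      then show "norm (u k - ?e) \<le> 1" using al[of "k - b"] by simp
    qed (use that in auto)
    moreover have "norm (\<zeta> - z (Suc b)) \<le> 2 * (?e \<bullet> (\<zeta> - z (Suc b)))"
      using jump ub by (simp add: power2_norm_eq_inner[symmetric])
    moreover have "norm (\<zeta> - z (b + j)) \<le> norm (\<zeta> - z (Suc b)) + norm (z (Suc b) - z (b + j))"
      using norm_triangle_ineq[of "\<zeta> - z (Suc b)" "z (Suc b) - z (b + j)"] by simp
    ultimately show ?thesis by (simp add: inner_diff algebra_simps)
  qed
  have low: "- (C * sqrt (real k)) \<le> ?e \<bullet> (\<Sum>j\<in>{b<..b+k}. z j)" if "k \<le> l" for k
  proof -
    let ?S = "\<Sum>j\<in>{b<..b+k}. z j"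
    have "\<bar>?e \<bullet> (?S - (lam / 2) *\<^sub>R (u b - u (b + k)))\<bar> \<le> C * sqrt (real k)"
      using Cauchy_Schwarz_ineq2[of ?e "?S - (lam / 2) *\<^sub>R (u b - u (b + k))"]
        tv_flowD(3)[OF fl, of b "b + k"] that l ub by simp
    moreover have "?e \<bullet> u (b + k) \<le> 1"
      using norm_cauchy_schwarz[of ?e "u (b + k)"] tv_flowD(1)[OF fl, of "b + k"] that l ub by simp
    then have "0 \<le> (lam / 2) * (?e \<bullet> (u b - u (b + k)))"
      using lam ub by (simp add: inner_diff power2_norm_eq_inner[symmetric])
    ultimately show ?thesis by (simp add: inner_diff)
  qed
  \<comment> \<open>A turn up to step k only involves the values up to b + k, and those are controlled by the
    dual vectors strictly before b + k; so strong induction closes the loop.\<close>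
  have aligned: "norm (u (b + k) - ?e) \<le> 1" if "k \<le> l" for k
    using that
  proof (induction k rule: less_induct)
    case (less k)
    show ?case
    proof (cases "k = 0")
      case False
      let ?S = "\<Sum>j\<in>{b<..b+k}. z j"
      have "norm (z j) \<le> R + 2 * (?e \<bullet> \<zeta>) - 2 * (?e \<bullet> z j)" if j: "j \<in> {b<..b+k}" for j
      proof -
        have "norm (\<zeta> - z (b + (j - b))) \<le> 2 * (?e \<bullet> (\<zeta> - z (b + (j - b))))"
          by (rule drop) (use j less l in auto)
        then have "norm (\<zeta> - z j) \<le> 2 * (?e \<bullet> (\<zeta> - z j))" using j by simp
        moreover have "norm (z j) \<le> norm \<zeta> + norm (\<zeta> - z j)"
          using norm_triangle_ineq4[of \<zeta> "\<zeta> - z j"] by simp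
        ultimately show ?thesis using zR by (simp add: inner_diff)
      qed
      then have "norm ?S \<le> (\<Sum>j\<in>{b<..b+k}. R + 2 * (?e \<bullet> \<zeta>) - 2 * (?e \<bullet> z j))"
        by (rule sum_norm_le)
      also have "\<dots> = real k * (R + 2 * (?e \<bullet> \<zeta>)) - 2 * (?e \<bullet> ?S)"
        by (simp add: sum_subtractf inner_sum_right sum_distrib_left)
      also have "\<dots> \<le> real k * (R + 2 * R) + 2 * (C * sqrt (real k))"
      proof -
        have "?e \<bullet> \<zeta> \<le> R" using norm_cauchy_schwarz[of ?e \<zeta>] ub zR by simp
        then have "real k * (R + 2 * (?e \<bullet> \<zeta>)) \<le> real k * (R + 2 * R)"
          by (intro mult_left_mono) auto
        then show ?thesis using low[of k] less.prems by simp
      qed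
      finally have "norm ?S \<le> 3 * (real k * R) + 2 * (C * sqrt (real k))" by simp
      moreover have "norm (?S - (lam / 2) *\<^sub>R (u b - u (b + k))) \<le> C * sqrt (real k)"
        using tv_flowD(3)[OF fl, of b "b + k"] less.prems l by simp
      moreover have "norm ((lam / 2) *\<^sub>R (u b - u (b + k)))
          \<le> norm ?S + norm (?S - (lam / 2) *\<^sub>R (u b - u (b + k)))"
        using norm_triangle_ineq4[of ?S "?S - (lam / 2) *\<^sub>R (u b - u (b + k))"] by simp
      ultimately have "(lam / 2) * norm (u b - u (b + k)) \<le> 3 * (real k * R + C * sqrt (real k))"
        using lam by simp
      also have "\<dots> \<le> 3 * (real l * R + C * sqrt (real l))"
        using less.prems R C by (intro mult_left_mono add_mono mult_right_mono) auto
      also have "\<dots> \<le> lam / 2 * 1" using small by simp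
      finally show ?thesis using lam by (simp add: norm_minus_commute)
    qed simp
  qed
  have "?e \<bullet> z j \<le> ?e \<bullet> z (Suc b)" if j: "j \<in> {b<..b+l}" for j
  proof -
    have "norm (z (Suc b) - z j) \<le> 2 * (?e \<bullet> (z (Suc b) - z j))"
    proof (rule aligned_drop[OF fl ub])
      fix k assume k: "Suc b \<le> k" "k < j"
      have "k = b + (k - b)" "k - b \<le> l" using k j by auto
      then show "norm (u k - ?e) \<le> 1" using aligned[of "k - b"] by simp
    qed (use j l in auto)
    then have "0 \<le> 2 * (?e \<bullet> (z (Suc b) - z j))" by (rule order_trans[OF norm_ge_zero])
    then show ?thesis by (simp add: inner_diff)
  qed
  then have "(\<Sum>j\<in>{b<..b+l}. ?e \<bullet> z j) \<le> (\<Sum>j\<in>{b<..b+l}. ?e \<bullet> z (Suc b))"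
    by (rule sum_mono)
  then have "- (C * sqrt (real l)) \<le> real l * (?e \<bullet> z (Suc b))"
    using low[of l] by (simp add: inner_sum_right)
  moreover have "C * sqrt (real l) = real l * (C / sqrt (real l))"
    using l by (simp add: field_simps)
  ultimately have "real l * (- (C / sqrt (real l))) \<le> real l * (?e \<bullet> z (Suc b))" by simp
  then show ?thesis using l by (simp only: mult_le_cancel_left_pos of_nat_0_less_iff)
qed

text \<open>
  This crude bound uses only the two steps adjacent to the jump.  With \<open>p\<close> and \<open>q\<close> the denoised values
  before and after it, staying in the unit ball forces \<open>u b \<bullet> p \<le> - \<parallel>p\<parallel>\<^sup>2 / lam\<close> and \<open>u b \<bullet> q \<ge> 0\<close>;
  the jump goes the opposite way, up to noise \<open>2 C\<close>.
\<close>

lemma jump_height: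
  fixes z u :: "nat \<Rightarrow> 'v::real_inner"
  assumes fl: "tv_flow m lam C z u" and lam: "0 < lam"
    and b: "1 \<le> b" "b < m" and ub: "norm (u b) = 1"
  shows "norm (z b) \<le> C + sqrt (2 * C * lam)"
proof -
  let ?e = "u b"
  define p where "p = (lam / 2) *\<^sub>R (u (b - 1) - u b)"
  define q where "q = (lam / 2) *\<^sub>R (u b - u (Suc b))"
  have zp: "norm (z b - p) \<le> C"
  proof -
    have "{b - 1<..b} = {b}" using b by auto
    then show ?thesis using tv_flowD(3)[OF fl, of "b - 1" b] b unfolding p_def by simp
  qed
  have zq: "norm (z (Suc b) - q) \<le> C"
  proof -
    have "{b<..Suc b} = {Suc b}" by auto
    then show ?thesis using tv_flowD(3)[OF fl, of b "Suc b"] b unfolding q_def by simp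
  qed
  have ep: "?e \<bullet> p \<le> - (norm p)\<^sup>2 / lam"
  proof -
    have "(norm (u (b - 1)))\<^sup>2 \<le> 1" using tv_flowD(1)[OF fl, of "b - 1"] b by (simp add: power_le_one)
    moreover have "u (b - 1) = ?e + (2 / lam) *\<^sub>R p" using lam by (simp add: p_def)
    then have "(norm (u (b - 1)))\<^sup>2 = (norm ?e)\<^sup>2 + 4 / lam * (?e \<bullet> p) + (2 / lam)\<^sup>2 * (norm p)\<^sup>2"
      unfolding power2_norm_eq_inner
      by (simp add: inner_add inner_commute power2_eq_square algebra_simps)
    moreover have "4 / lam * (?e \<bullet> p + (norm p)\<^sup>2 / lam)
        = 4 / lam * (?e \<bullet> p) + (2 / lam)\<^sup>2 * (norm p)\<^sup>2"
      by (simp add: power2_eq_square distrib_left)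
    ultimately have "4 / lam * (?e \<bullet> p + (norm p)\<^sup>2 / lam) \<le> 0"
      using ub by simp
    then show ?thesis using lam by (simp add: mult_le_0_iff divide_le_0_iff)
  qed
  have eq: "0 \<le> ?e \<bullet> q"
  proof -
    have "?e \<bullet> u (Suc b) \<le> 1"
      using norm_cauchy_schwarz[of ?e "u (Suc b)"] tv_flowD(1)[OF fl, of "Suc b"] b ub by simp
    then show ?thesis using lam ub
      by (simp add: q_def inner_diff power2_norm_eq_inner[symmetric])
  qed
  have "?e \<bullet> (z b - z (Suc b)) = norm (z b - z (Suc b)) * (norm ?e)\<^sup>2"
    by (subst tv_flowD(2)[OF fl b]) (simp add: power2_norm_eq_inner)
  then have "0 \<le> ?e \<bullet> (z b - z (Suc b))" by simp
  moreover have "?e \<bullet> (z b - p) \<le> C" "- C \<le> ?e \<bullet> (z (Suc b) - q)"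
    using Cauchy_Schwarz_ineq2[of ?e "z b - p"] Cauchy_Schwarz_ineq2[of ?e "z (Suc b) - q"] ub zp zq
    by auto
  ultimately have "(norm p)\<^sup>2 / lam \<le> 2 * C" using ep eq by (simp add: inner_diff)
  then have "(norm p)\<^sup>2 \<le> 2 * C * lam" using lam by (simp add: field_simps)
  then have "norm p \<le> sqrt (2 * C * lam)" by (simp add: real_le_rsqrt)
  moreover have "norm (z b) \<le> norm (z b - p) + norm p"
    using norm_triangle_ineq[of "z b - p" p] by simp
  ultimately show ?thesis using zp by simp
qed

lemma first_jump:
  assumes "i \<le> b" "z (Suc b) \<noteq> z i"
  obtains j where "i \<le> j" "j \<le> b" "z j = z i" "z (Suc j) \<noteq> z j"
proof -
  have "\<exists>j. i \<le> j \<and> j \<le> b \<and> z j = z i \<and> z (Suc j) \<noteq> z j"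
    using assms
  proof (induction b rule: dec_induct)
    case base
    then show ?case by auto
  next
    case (step b)
    then show ?case by (metis le_Suc_eq)
  qed
  then show ?thesis using that by blast
qed

text \<open>
  This is the core of the argument.  Put \<open>e = u b\<close>, the direction of the exit jump, and let \<open>j\<close> be the
  first jump at or after \<open>i\<close>.  The window right of \<open>b\<close> gives \<open>e \<bullet> z (Suc b) \<ge> - r / 10\<close>, the window left of
  \<open>j\<close> gives \<open>u j \<bullet> z i \<le> r / 10\<close>, and passing from \<open>u j\<close> to \<open>e\<close> costs at most \<open>r / 50\<close>, because a
  long run with \<open>z\<close> near \<open>z i\<close> can only lower \<open>u \<bullet> z i\<close> while a short run hardly turns \<open>u\<close>.  As all
  jumps in between are aligned with \<open>e\<close>, the displacement from \<open>z i\<close> to \<open>z (Suc b)\<close> is at most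
  \<open>2 (r / 10 + r / 50 + r / 10) < r / 2\<close>.
\<close>

lemma exit_right_impossible:
  fixes z u :: "nat \<Rightarrow> 'v::real_inner"
  assumes fl: "tv_flow m lam C z u" and C: "0 \<le> C"
    and i: "1 \<le> i" "i \<le> b" "b < m" and r: "r = norm (z i)" "0 < r"
    and near: "\<And>k. i \<le> k \<Longrightarrow> k \<le> b \<Longrightarrow> norm (z k - z i) \<le> r / 2"
    and far: "r / 2 < norm (z (Suc b) - z i)"
    and l: "1 \<le> l" "l \<le> i" "b + l \<le> m"
    and noise: "100 * C\<^sup>2 \<le> r\<^sup>2 * real l" and turn: "10 * r * real l \<le> lam"
  shows False
proof -
  let ?e = "u b"
  have rl: "0 < r * real l" using r l by simp
  then have lam: "0 < lam" using turn by linarith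
  have Cs: "C * sqrt (real N) \<le> r * real N / 10" if "l \<le> N" for N
  proof (rule power2_le_imp_le)
    have "100 * (C\<^sup>2 * real N) \<le> (r\<^sup>2 * real l) * real N"
      using mult_right_mono[OF noise, of "real N"] by (simp add: mult.assoc)
    also have "\<dots> \<le> (r\<^sup>2 * real N) * real N"
      using that by (intro mult_right_mono mult_left_mono) auto
    finally show "(C * sqrt (real N))\<^sup>2 \<le> (r * real N / 10)\<^sup>2"
      by (simp add: power_mult_distrib power_divide power2_eq_square algebra_simps)
  qed (use r in auto)
  have Cs': "C * sqrt (real N) \<le> r * real l / 10" if "N \<le> l" for N
    using Cs[of l] that C by (meson le_refl mult_left_mono of_nat_le_iff order_trans real_sqrt_le_mono)
  have Cl: "C / sqrt (real l) \<le> r / 10"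
  proof -
    have "real l * (C / sqrt (real l)) = C * sqrt (real l)" using l by (simp add: field_simps)
    also have "\<dots> \<le> real l * (r / 10)" using Cs[of l] by (simp add: mult.commute)
    finally show ?thesis using l by (simp only: mult_le_cancel_left_pos of_nat_0_less_iff)
  qed
  have zk: "norm (z k) \<le> 3 / 2 * r" if "i \<le> k" "k \<le> b" for k
    using near[OF that] norm_triangle_ineq[of "z k - z i" "z i"] r by simp
  have zz: "r\<^sup>2 / 2 \<le> z k \<bullet> z i" if "i \<le> k" "k \<le> b" for k
    using inner_ge_of_near[of "z k" "z i"] near[OF that] r by simp
  have "z (Suc b) \<noteq> z b" using near[of b] far i by auto
  then have ub: "norm ?e = 1" using unit_at_jump[OF fl, of b] i by auto
  have small: "6 * (real l * (3 / 2 * r) + C * sqrt (real l)) \<le> lam"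
    using Cs[of l] turn rl by (simp add: algebra_simps)
  have right: "- (r / 10) \<le> ?e \<bullet> z (Suc b)"
    using outward_window[OF fl lam C l(1) l(3) ub, of "z b" "norm (z b - z (Suc b))" "3 / 2 * r"]
      tv_flowD(2)[OF fl, of b] i zk[of b] small Cl by auto
  \<comment> \<open>S is the sum of z from k to the exit; W is its noiseless value by stationarity.\<close>
  define W where "W k = (lam / 2) *\<^sub>R (u k - ?e)" for k
  define S where "S k = (\<Sum>j\<in>{k<..b}. z j)" for k
  have SW: "norm (S k - W k) \<le> C * sqrt (real (b - k))" if "k \<le> b" for k
    using tv_flowD(3)[OF fl, of k b] that i unfolding S_def W_def by simp
  have Sz: "real (b - k) * (r\<^sup>2 / 2) \<le> S k \<bullet> z i" if "i \<le> k" "k \<le> b" for k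
  proof -
    have "(\<Sum>j\<in>{k<..b}. r\<^sup>2 / 2) \<le> (\<Sum>j\<in>{k<..b}. z j \<bullet> z i)"
      by (rule sum_mono) (use zz that in auto)
    then show ?thesis by (simp add: S_def inner_sum_left)
  qed
  \<comment> \<open>Backward induction from the exit.  On a long run, membership of u k in the unit ball bounds the
    square of its distance from e linearly in the run length, whereas the mass of z along z i bounds the
    distance itself from below by the same linear quantity; together they leave only distances
    up to 1.  On a run shorter than l, the vector u cannot turn far anyway.\<close>
  have "\<forall>j. i \<le> j \<longrightarrow> j \<le> b \<longrightarrow> norm (u j - ?e) \<le> 1"
    using i(2)
  proof (induction i rule: inc_induct)
    case base
    then show ?case by auto
  next
    case (step k)
    define N where "N = b - k"
    define \<delta> where "\<delta> = u k - ?e"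
    have N: "1 \<le> N" "real N > 0" using step.hyps by (auto simp: N_def)
    have ik: "i \<le> k" "k \<le> b" using step.hyps by auto
    have W: "W k = (lam / 2) *\<^sub>R \<delta>" by (simp add: W_def \<delta>_def)
    have SWk: "norm (S k - W k) \<le> C * sqrt (real N)" using SW[OF ik(2)] by (simp add: N_def)
    have "- (r / 10) \<le> ?e \<bullet> z j" if "j \<in> {k<..b}" for j
    proof -
      have "norm (z j - z (Suc b)) \<le> 2 * (?e \<bullet> (z j - z (Suc b)))"
        by (rule aligned_drop[OF fl ub]) (use that i step in auto)
      then have "0 \<le> 2 * (?e \<bullet> (z j - z (Suc b)))" by (rule order_trans[OF norm_ge_zero])
      then show ?thesis using right by (simp add: inner_diff)
    qed
    then have "(\<Sum>j\<in>{k<..b}. - (r / 10)) \<le> (\<Sum>j\<in>{k<..b}. ?e \<bullet> z j)" by (rule sum_mono)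
    then have eS: "- (real N * r / 10) \<le> ?e \<bullet> S k" by (simp add: S_def inner_sum_right N_def)
    have "\<bar>?e \<bullet> (S k - W k)\<bar> \<le> C * sqrt (real N)"
      using Cauchy_Schwarz_ineq2[of ?e "S k - W k"] SWk ub by simp
    then have e\<delta>: "- (real N * r / 10) - C * sqrt (real N) \<le> (lam / 2) * (?e \<bullet> \<delta>)"
      using eS unfolding inner_diff_right W inner_scaleR_right by linarith
    have "norm \<delta> \<le> 1"
    proof (cases "l \<le> N")
      case True
      have CN: "C * sqrt (real N) \<le> r * real N / 10" by (rule Cs[OF True])
      have "(norm (u k))\<^sup>2 \<le> 1" using tv_flowD(1)[OF fl, of k] ik i by (simp add: power_le_one)
      moreover have "u k = ?e + \<delta>" by (simp add: \<delta>_def)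
      then have "(norm (u k))\<^sup>2 = (norm ?e)\<^sup>2 + 2 * (?e \<bullet> \<delta>) + (norm \<delta>)\<^sup>2"
        unfolding power2_norm_eq_inner by (simp add: inner_add inner_commute)
      ultimately have "(norm \<delta>)\<^sup>2 \<le> - 2 * (?e \<bullet> \<delta>)" using ub by simp
      then have "lam * (norm \<delta>)\<^sup>2 \<le> lam * (- 2 * (?e \<bullet> \<delta>))"
        using lam by (intro mult_left_mono) auto
      also have "\<dots> \<le> 4 * (real N * r / 10 + C * sqrt (real N))" using e\<delta> by (simp add: algebra_simps)
      also have "\<dots> \<le> 8 / 10 * (r * real N)" using CN by (simp add: algebra_simps)
      finally have up: "lam * (norm \<delta>)\<^sup>2 \<le> 8 / 10 * (r * real N)" .
      have "real N * (r\<^sup>2 / 2) \<le> norm (S k) * r"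
        using Sz[OF ik] norm_cauchy_schwarz[of "S k" "z i"] r by (simp add: N_def)
      then have "(real N * (r / 2)) * r \<le> norm (S k) * r" by (simp add: power2_eq_square)
      then have "real N * (r / 2) \<le> norm (S k)" using r by (simp only: mult_le_cancel_right_pos)
      moreover have "norm (S k) \<le> norm (S k - W k) + norm (W k)"
        using norm_triangle_ineq[of "S k - W k" "W k"] by simp
      ultimately have "4 / 10 * (r * real N) \<le> norm (W k)" using CN SWk by (simp add: algebra_simps)
      then have "8 / 10 * (r * real N) \<le> lam * norm \<delta>" using lam W by simp
      then have le: "lam * (norm \<delta>)\<^sup>2 \<le> lam * norm \<delta>" using up by linarith
      show ?thesis
      proof (rule ccontr)
        assume "\<not> norm \<delta> \<le> 1"
        then have "norm \<delta> * 1 < norm \<delta> * norm \<delta>" by (intro mult_strict_left_mono) auto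
        then have "lam * norm \<delta> < lam * (norm \<delta>)\<^sup>2" using lam by (simp add: power2_eq_square)
        then show False using le by simp
      qed
    next
      case False
      have "norm (S k) \<le> (\<Sum>j\<in>{k<..b}. 3 / 2 * r)"
        unfolding S_def by (rule sum_norm_le) (use zk ik in auto)
      also have "\<dots> = real N * (3 / 2 * r)" by (simp add: N_def)
      also have "\<dots> \<le> real l * (3 / 2 * r)" using False r by (intro mult_right_mono) auto
      finally have "norm (S k) \<le> 3 / 2 * (r * real l)" by (simp add: mult_ac)
      moreover have "norm (W k) \<le> norm (S k) + norm (S k - W k)"
        using norm_triangle_ineq4[of "S k" "S k - W k"] by simp
      ultimately have "norm (W k) \<le> 16 / 10 * (r * real l)" using SWk Cs'[of N] False by simp
      then have "lam * norm \<delta> \<le> 32 / 10 * (r * real l)" using lam W by simp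
      also have "\<dots> \<le> lam * 1" using turn rl by (simp add: mult.assoc)
      finally have "lam * norm \<delta> \<le> lam * 1" .
      then show ?thesis using lam by simp
    qed
    then show ?case using step.IH unfolding \<delta>_def by (metis Suc_leI le_neq_implies_less)
  qed
  then have aligned: "norm (u k - ?e) \<le> 1" if "i \<le> k" "k \<le> b" for k using that by blast
  obtain j where j: "i \<le> j" "j \<le> b" "z j = z i" "z (Suc j) \<noteq> z j"
    using first_jump[OF i(2)] far r by (metis diff_self norm_zero half_gt_zero not_less_iff_gr_or_eq)
  have uj: "norm (u j) = 1" using unit_at_jump[OF fl, of j] i j by auto
  have left: "u j \<bullet> z i \<le> r / 10"
  proof -
    let ?z = "\<lambda>k. z (m + 1 - k)" and ?u = "\<lambda>k. - u (m - k)"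
    have "m - (m - j) = j" "m + 1 - Suc (m - j) = j" using i j by auto
    then have "- (C / sqrt (real l)) \<le> ?u (m - j) \<bullet> ?z (Suc (m - j))"
      using outward_window[OF tv_flow_reflect[OF fl] lam C l(1), of "m - j" "z j" 0 "3 / 2 * r"]
        l i j uj zk[of j] small by auto
    then have "u j \<bullet> z i \<le> C / sqrt (real l)" using j i by simp
    then show ?thesis using Cl by linarith
  qed
  have "?e \<bullet> z i \<le> r / 10 + r / 50"
  proof -
    define N where "N = b - j"
    have "real N * (r\<^sup>2 / 2) \<le> S j \<bullet> z i" using Sz[OF j(1,2)] by (simp add: N_def)
    moreover have "\<bar>(S j - W j) \<bullet> z i\<bar> \<le> C * sqrt (real N) * r"
      unfolding N_def r(1)
      by (rule order_trans[OF Cauchy_Schwarz_ineq2 mult_right_mono[OF SW[OF j(2)]]]) simp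
    ultimately have Wz: "real N * (r\<^sup>2 / 2) - C * sqrt (real N) * r \<le> W j \<bullet> z i"
      by (simp add: inner_diff)
    have "- (r * (r * real l / 10)) \<le> W j \<bullet> z i"
    proof (cases "l \<le> N")
      case True
      have "C * sqrt (real N) * r \<le> r * real N / 10 * r"
        using Cs[OF True] r by (intro mult_right_mono) auto
      also have "\<dots> \<le> real N * (r\<^sup>2 / 2)"
        using r by (simp add: power2_eq_square mult_nonneg_nonneg)
      finally have "0 \<le> W j \<bullet> z i" using Wz by linarith
      moreover have "0 \<le> r * (r * real l / 10)" using r by simp
      ultimately show ?thesis by linarith
    next
      case False
      have "C * sqrt (real N) * r \<le> r * real l / 10 * r"
        using Cs'[of N] False r by (intro mult_right_mono) auto
      moreover have "0 \<le> real N * (r\<^sup>2 / 2)" by simp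
      moreover have "r * real l / 10 * r = r * (r * real l / 10)" by simp
      ultimately show ?thesis using Wz by linarith
    qed
    moreover have "r * (r * real l / 10) \<le> r * (lam / 100)"
      using turn r(2) by (intro mult_left_mono) auto
    ultimately have "- (r * (lam / 100)) \<le> W j \<bullet> z i" by linarith
    then have "- (r * (lam / 100)) \<le> (lam / 2) * ((u j - ?e) \<bullet> z i)"
      unfolding W_def inner_scaleR_left .
    then have "lam * (- (r / 50)) \<le> lam * ((u j - ?e) \<bullet> z i)" by (simp add: algebra_simps)
    then have "- (r / 50) \<le> (u j - ?e) \<bullet> z i" using lam by (simp only: mult_le_cancel_left_pos)
    then show ?thesis using left by (simp add: inner_diff)
  qed
  moreover have "norm (z i - z (Suc b)) \<le> 2 * (?e \<bullet> (z i - z (Suc b)))"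
    by (rule aligned_drop[OF fl ub]) (use i aligned in auto)
  ultimately show False using far right r by (simp add: inner_diff norm_minus_commute)
qed

lemma height_bound_of_nonconstant:
  fixes z u :: "nat \<Rightarrow> 'v::real_inner"
  assumes fl: "tv_flow m lam C z u" and lam: "0 < lam"
    and i: "1 \<le> i" "i \<le> b" "b < m" and ne: "z (Suc b) \<noteq> z i"
  shows "norm (z i) \<le> C + sqrt (2 * C * lam)"
proof -
  obtain j where j: "i \<le> j" "j \<le> b" "z j = z i" "z (Suc j) \<noteq> z j"
    using first_jump[OF i(2) ne] by metis
  then show ?thesis
    using jump_height[OF fl lam, of j] unit_at_jump[OF fl, of j] i by auto
qed

text \<open>
  The scale \<open>l = \<lceil>100 C\<^sup>2 / r\<^sup>2\<rceil>\<close>.  Its cost \<open>r l \<le> 100 C\<^sup>2 / r + r\<close> is compared with \<open>lam\<close> term by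
  term.  The lower bound on \<open>r\<close> says \<open>15625 C\<^sup>3 < r\<^sup>2 lam\<close>; multiplied by \<open>625 C \<le> lam\<close> this is
  \<open>(3125 C\<^sup>2)\<^sup>2 \<le> (r lam)\<^sup>2\<close>.  The second term, which matters because of the rounding when \<open>r\<close> is large,
  is controlled by \<open>jump_height\<close>.
\<close>

lemma exit_scale:
  assumes C: "0 < C" and lam: "25\<^sup>2 * C \<le> lam" and r: "0 < r"
    and r1: "125 * sqrt (C ^ 3 / lam) < r" and r2: "r \<le> C + sqrt (2 * C * lam)"
  obtains l :: nat where "1 \<le> l" "100 * C\<^sup>2 \<le> r\<^sup>2 * real l" "10 * r * real l \<le> lam"
    "\<And>k::nat. 100 * C\<^sup>2 \<le> r\<^sup>2 * real k \<Longrightarrow> l \<le> k"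
proof -
  define l where "l = nat \<lceil>100 * C\<^sup>2 / r\<^sup>2\<rceil>"
  have lp: "0 < lam" using C lam by simp
  have pos: "0 < 100 * C\<^sup>2 / r\<^sup>2" using C r by simp
  have 1: "1 \<le> l" using pos unfolding l_def by linarith
  have "100 * C\<^sup>2 / r\<^sup>2 \<le> real l" unfolding l_def by linarith
  then have 2: "100 * C\<^sup>2 \<le> r\<^sup>2 * real l" using r by (simp add: field_simps)
  have lu: "real l \<le> 100 * C\<^sup>2 / r\<^sup>2 + 1" using pos unfolding l_def by linarith
  have rlam: "3125 * C\<^sup>2 \<le> r * lam"
  proof (rule power2_le_imp_le)
    have "(125 * sqrt (C ^ 3 / lam))\<^sup>2 \<le> r\<^sup>2"
      using r1 C lp by (intro power_mono) auto
    then have a: "15625 * C ^ 3 \<le> r\<^sup>2 * lam"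
      using C lp by (simp add: power_mult_distrib field_simps)
    have "(3125 * C\<^sup>2)\<^sup>2 = (15625 * C ^ 3) * (25\<^sup>2 * C)" by (simp add: power_def numeral_eq_Suc)
    also have "\<dots> \<le> (r\<^sup>2 * lam) * lam" using mult_mono[OF a lam] C lp by simp
    finally show "(3125 * C\<^sup>2)\<^sup>2 \<le> (r * lam)\<^sup>2" by (simp add: power2_eq_square algebra_simps)
  qed (use r lp in auto)
  have "sqrt (2 * C * lam) \<le> 57 / 1000 * lam"
  proof (rule real_le_lsqrt)
    have "2 * (25\<^sup>2 * C) * lam \<le> 2 * lam * lam" using lam lp by (intro mult_right_mono) auto
    then show "2 * C * lam \<le> (57 / 1000 * lam)\<^sup>2"
      using lp by (simp add: power2_eq_square field_simps)
  qed (use C lp in auto)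
  moreover have "625 * C \<le> lam" using lam by simp
  ultimately have rl: "r \<le> 587 / 10000 * lam" using r2 lp by linarith
  have "r * real l \<le> r * (100 * C\<^sup>2 / r\<^sup>2 + 1)" using lu r by (intro mult_left_mono) auto
  also have "\<dots> = 100 * C\<^sup>2 / r + r" using r by (simp add: power2_eq_square field_simps)
  also have "\<dots> \<le> 100 / 3125 * lam + 587 / 10000 * lam"
    using rlam rl r by (intro add_mono) (simp_all add: field_simps)
  finally have 3: "10 * r * real l \<le> lam" using lp by simp
  have "l \<le> k" if "100 * C\<^sup>2 \<le> r\<^sup>2 * real k" for k :: nat
  proof -
    have "100 * C\<^sup>2 / r\<^sup>2 \<le> real k" using that r by (simp add: field_simps)
    then show ?thesis unfolding l_def by (simp add: nat_le_iff ceiling_le_iff)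
  qed
  then show ?thesis using that 1 2 3 by blast
qed


lemma less_sqrt_quotient:
  fixes k :: nat
  assumes "0 < C" "0 < c" "1 \<le> k" "c * C / sqrt (real k) < r"
  shows "c\<^sup>2 * C\<^sup>2 < r\<^sup>2 * real k"
proof -
  have "c * C < r * sqrt (real k)" using assms by (simp add: field_simps)
  then have "(c * C)\<^sup>2 < (r * sqrt (real k))\<^sup>2" using assms by (intro power_strict_mono) auto
  then show ?thesis by (simp add: power_mult_distrib)
qed

text \<open>
  The bounds on \<open>r\<close> in terms of \<open>i\<close> and of \<open>m\<close> say that windows of length \<open>l\<close> fit to the left of \<open>i\<close> and
  into a quarter of the piece: \<open>25 \<surd>5\<close> squares to \<open>3125\<close> and \<open>50\<close> to \<open>2500 = 4 \<cdot> 625\<close>, both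
  with slack over the required \<open>100\<close> and \<open>4 \<cdot> 100\<close>.
\<close>

lemma exit_with_room_impossible:
  fixes z u :: "nat \<Rightarrow> 'v::real_inner"
  assumes fl: "tv_flow m lam C z u" and C: "0 < C" and lam: "25\<^sup>2 * C \<le> lam"
    and i: "1 \<le> i" "i \<le> b" "b < m" and r: "r = norm (z i)" "0 < r"
    and near: "\<And>k. i \<le> k \<Longrightarrow> k \<le> b \<Longrightarrow> norm (z k - z i) \<le> r / 2"
    and far: "r / 2 < norm (z (Suc b) - z i)"
    and room: "m < 4 * (m - b)"
    and r_piece: "50 * C / sqrt (real m) < r"
    and r_dist: "25 * sqrt 5 * C / sqrt (real i) < r"
    and r_lam: "125 * sqrt (C ^ 3 / lam) < r"
  shows False
proof -
  have "0 < lam" using C lam by simp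
  moreover have "z (Suc b) \<noteq> z i" using far r by auto
  ultimately have "r \<le> C + sqrt (2 * C * lam)"
    using height_bound_of_nonconstant[OF fl _ i] r by simp
  then obtain l :: nat where l: "1 \<le> l" "100 * C\<^sup>2 \<le> r\<^sup>2 * real l" "10 * r * real l \<le> lam"
    and least: "\<And>k::nat. 100 * C\<^sup>2 \<le> r\<^sup>2 * real k \<Longrightarrow> l \<le> k"
    using exit_scale[OF C lam r(2) r_lam] by metis
  have "3125 * C\<^sup>2 < r\<^sup>2 * real i"
    using less_sqrt_quotient[OF C _ i(1) r_dist] by (simp add: power_mult_distrib)
  moreover have "0 \<le> C\<^sup>2" by simp
  ultimately have "l \<le> i" by (intro least) linarith
  moreover have "l \<le> m - b"
  proof (rule least)
    have "2500 * C\<^sup>2 < r\<^sup>2 * real m"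
      using less_sqrt_quotient[OF C _ _ r_piece] i by simp
    also have "\<dots> \<le> r\<^sup>2 * (4 * real (m - b))" using room by (intro mult_left_mono) auto
    finally show "100 * C\<^sup>2 \<le> r\<^sup>2 * real (m - b)" using \<open>0 \<le> C\<^sup>2\<close> by linarith
  qed
  ultimately show False
    using exit_right_impossible[OF fl _ i r near far l(1) _ _ l(2,3)] C i by linarith
qed

lemma maximal_right_run:
  assumes "P i" "i \<le> (m::nat)"
  obtains b where "i \<le> b" "b \<le> m" "\<And>k. i \<le> k \<Longrightarrow> k \<le> b \<Longrightarrow> P k" "b < m \<Longrightarrow> \<not> P (Suc b)"
proof -
  have "\<exists>b. i \<le> b \<and> b \<le> m \<and> (\<forall>k. i \<le> k \<longrightarrow> k \<le> b \<longrightarrow> P k) \<and> (b < m \<longrightarrow> \<not> P (Suc b))"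
    using assms(2)
  proof (induction m rule: dec_induct)
    case base
    show ?case using assms(1) by (intro exI[of _ i]) (auto dest: le_antisym)
  next
    case (step m)
    then obtain b where b: "i \<le> b" "b \<le> m" "\<forall>k. i \<le> k \<longrightarrow> k \<le> b \<longrightarrow> P k" "b < m \<longrightarrow> \<not> P (Suc b)"
      by blast
    show ?case
    proof (cases "b = m \<and> P (Suc m)")
      case True
      then show ?thesis using b by (intro exI[of _ "Suc m"]) (auto simp: le_Suc_eq)
    next
      case False
      then show ?thesis using b by (intro exI[of _ b]) auto
    qed
  qed
  then show ?thesis using that by blast
qed

lemma tv_flow_error_bound:
  fixes z u :: "nat \<Rightarrow> 'v::real_inner"
  assumes fl: "tv_flow m lam C z u" and C: "0 < C" and lam: "25\<^sup>2 * C \<le> lam"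
    and i: "1 \<le> i" "i \<le> m"
  shows "norm (z i) \<le> error_bound C lam (real m) (real (min i (m + 1 - i)))"
proof (rule ccontr)
  define r where "r = norm (z i)"
  assume "\<not> ?thesis"
  then have r_mean: "4 * (C * sqrt (real m / 2) + lam) / real m < r"
    and r_piece: "50 * C / sqrt (real m) < r"
    and r_dist: "25 * sqrt 5 * C / sqrt (real (min i (m + 1 - i))) < r"
    and r_lam: "125 * sqrt (C ^ 3 / lam) < r"
    unfolding error_bound_def r_def not_le by (simp_all add: Max_less_iff)
  have lp: "0 < lam" using C lam by simp
  have "0 \<le> 50 * C / sqrt (real m)" using C by simp
  then have r0: "0 < r" using r_piece by linarith
  have d_le: "25 * sqrt 5 * C / sqrt (real k) < r" if "min i (m + 1 - i) \<le> k" for k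
  proof -
    have "25 * sqrt 5 * C / sqrt (real k) \<le> 25 * sqrt 5 * C / sqrt (real (min i (m + 1 - i)))"
      using that C i by (intro divide_left_mono mult_pos_pos) auto
    then show ?thesis using r_dist by linarith
  qed
  let ?z = "\<lambda>j. z (m + 1 - j)" and ?u = "\<lambda>j. - u (m - j)" and ?i = "m + 1 - i"
  have zi: "?z ?i = z i" using i by simp
  note fl' = tv_flow_reflect[OF fl]
  obtain b where b: "i \<le> b" "b \<le> m" "\<And>k. i \<le> k \<Longrightarrow> k \<le> b \<Longrightarrow> norm (z k - z i) \<le> r / 2"
    "b < m \<Longrightarrow> \<not> norm (z (Suc b) - z i) \<le> r / 2"
    using maximal_right_run[of "\<lambda>k. norm (z k - z i) \<le> r / 2" i m] i r0 by auto
  obtain c where c: "?i \<le> c" "c \<le> m" "\<And>k. ?i \<le> k \<Longrightarrow> k \<le> c \<Longrightarrow> norm (?z k - ?z ?i) \<le> r / 2"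
    "c < m \<Longrightarrow> \<not> norm (?z (Suc c) - ?z ?i) \<le> r / 2"
  proof -
    have start: "norm (?z ?i - ?z ?i) \<le> r / 2" "?i \<le> m" using i r0 by auto
    show ?thesis
      by (rule maximal_right_run[of "\<lambda>k. norm (?z k - ?z ?i) \<le> r / 2", OF start]) (rule that)
  qed
  have right: "\<not> m < 4 * (m - b)"
  proof
    assume "m < 4 * (m - b)"
    moreover from this have "b < m" by auto
    ultimately show False
      using exit_with_room_impossible[OF fl C lam i(1) b(1) _ r_def r0 b(3) _ _ r_piece d_le r_lam]
        b(4) by auto
  qed
  have left: "\<not> m < 4 * (m - c)"
  proof
    assume "m < 4 * (m - c)"
    moreover from this have "c < m" by auto
    moreover have "r = norm (?z ?i)" using zi by (simp add: r_def)
    moreover have "1 \<le> ?i" using i by simp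
    ultimately show False
      using exit_with_room_impossible[OF fl' C lam _ c(1) _ _ r0 c(3) _ _ r_piece d_le r_lam]
        c(4) by auto
  qed
  \<comment> \<open>The run is a + 1, ..., b; it covers half of the piece, since otherwise one of its ends would
    leave more than a quarter of the piece beyond it.\<close>
  define a where "a = m - c"
  define L where "L = b - a"
  have L: "m \<le> 2 * L" "a < i" using right left b(1,2) c(1,2) i by (auto simp: L_def a_def)
  then have ab: "a \<le> b" "L > 0" using i by (auto simp: L_def)
  have close: "norm (z k - z i) \<le> r / 2" if k: "k \<in> {a<..b}" for k
  proof (cases "i \<le> k")
    case True
    then show ?thesis using b(3)[of k] k by simp
  next
    case False
    then have "?i \<le> m + 1 - k" "m + 1 - k \<le> c" "m + 1 - (m + 1 - k) = k" using k b c i by (auto simp: a_def)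
    then show ?thesis using c(3)[of "m + 1 - k"] zi by simp
  qed
  let ?S = "\<Sum>k\<in>{a<..b}. z k"
  have "(\<Sum>k\<in>{a<..b}. r\<^sup>2 / 2) \<le> (\<Sum>k\<in>{a<..b}. z k \<bullet> z i)"
    unfolding r_def by (intro sum_mono inner_ge_of_near) (use close in \<open>simp add: r_def\<close>)
  also have "\<dots> = ?S \<bullet> z i" by (simp add: inner_sum_left)
  also have "\<dots> \<le> norm ?S * r" unfolding r_def by (rule norm_cauchy_schwarz)
  finally have "(real L * (r / 2)) * r \<le> norm ?S * r" by (simp add: L_def power2_eq_square)
  then have "real L * (r / 2) \<le> norm ?S" using r0 by (simp only: mult_le_cancel_right_pos)
  also have "\<dots> \<le> C * sqrt (real L) + lam"
  proof -
    have "norm (u a - u b) \<le> 2"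
      using norm_triangle_ineq4[of "u a" "u b"] tv_flowD(1)[OF fl, of a] tv_flowD(1)[OF fl, of b] ab b
      by simp
    then have "norm ((lam / 2) *\<^sub>R (u a - u b)) \<le> lam" using lp by simp
    moreover have "norm (?S - (lam / 2) *\<^sub>R (u a - u b)) \<le> C * sqrt (real L)"
      using tv_flowD(3)[OF fl ab(1) b(2)] by (simp add: L_def)
    ultimately show ?thesis
      using norm_triangle_ineq[of "?S - (lam / 2) *\<^sub>R (u a - u b)" "(lam / 2) *\<^sub>R (u a - u b)"] by simp
  qed
  also have "\<dots> = real L * (C / sqrt (real L) + lam / real L)"
    using ab by (simp add: field_simps)
  finally have mean: "r / 2 \<le> C / sqrt (real L) + lam / real L"
    using ab by (simp only: mult_le_cancel_left_pos of_nat_0_less_iff)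
  define h where "h = sqrt (real m / 2)"
  have h: "0 < h" "h * h = real m / 2" using i by (simp_all add: h_def)
  have "h \<le> sqrt (real L)" unfolding h_def using L by simp
  then have "C / sqrt (real L) \<le> C / h" using h C ab by (intro divide_left_mono mult_pos_pos) auto
  also have "\<dots> = 2 * (C * h) / real m" using h i by (simp add: field_simps)
  finally have "C / sqrt (real L) \<le> 2 * (C * h) / real m" .
  moreover have "lam / real L \<le> 2 * lam / real m"
    using L ab i lp by (simp add: field_simps)
  ultimately have "r / 2 \<le> 2 * (C * h) / real m + 2 * lam / real m"
    by (intro order_trans[OF mean] add_mono)
  then have "r \<le> 2 * (2 * (C * h) / real m + 2 * lam / real m)" by simp
  also have "\<dots> = 4 * (C * h + lam) / real m" by (simp add: add_divide_distrib algebra_simps)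
  finally show False using r_mean by (simp add: h_def)
qed

section \<open>Optimality and stability of total variation minimizers\<close>

lemma le_of_le_add_small:
  fixes a b c :: real
  assumes "0 \<le> c" "\<And>t. 0 < t \<Longrightarrow> t \<le> 1 \<Longrightarrow> a \<le> b + t * c"
  shows "a \<le> b"
proof (rule ccontr)
  assume "\<not> a \<le> b"
  then have ab: "0 < a - b" by simp
  define t where "t = min 1 ((a - b) / (2 * (c + 1)))"
  have t: "0 < t" "t \<le> 1" using ab assms(1) by (auto simp: t_def)
  have "t * c \<le> (a - b) / (2 * (c + 1)) * (c + 1)"
    using assms(1) ab by (intro mult_mono) (auto simp: t_def)
  also have "\<dots> = (a - b) / 2" using assms(1) by (simp add: field_simps)
  finally show False using assms(2)[OF t] ab by simp
qed

lemma is_tv_minimizerD: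
  assumes "is_tv_minimizer n lam y z"
  shows "z \<in> {1..n} \<rightarrow>\<^sub>E UNIV"
    and "w \<in> {1..n} \<rightarrow>\<^sub>E UNIV \<Longrightarrow> tv_objective n lam y z \<le> tv_objective n lam y w"
  using assms unfolding is_tv_minimizer_def is_arg_min_linorder by auto

text \<open>
  The solution \<open>u\<close> of \<open>(lam / 2) (u (k - 1) - u k) = z k - y k\<close> with \<open>u 0 = 0\<close>.
\<close>

definition tv_dual :: "real \<Rightarrow> (nat \<Rightarrow> real ^ 'p) \<Rightarrow> (nat \<Rightarrow> real ^ 'p) \<Rightarrow> nat \<Rightarrow> real ^ 'p" where
  "tv_dual lam y z k = (2 / lam) *\<^sub>R (\<Sum>j\<in>{0<..k}. y j - z j)"

text \<open>
  Shifting \<open>z 1, \<dots>, z k\<close> by \<open>t h\<close> affects a single term of the total variation (none if \<open>k\<close> is \<open>0\<close> or \<open>n\<close>)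
  and changes the quadratic part by \<open>- t lam (u k \<bullet> h)\<close> to first order.  By convexity the change of the norm is
  at most linear in \<open>t \<le> 1\<close>, so minimality, divided by \<open>t\<close>, gives the claim as \<open>t\<close> tends to \<open>0\<close>:
  \<open>u k\<close> is a subgradient of the norm at \<open>z k - z (Suc k)\<close>.
\<close>

lemma tv_dual_subgradient:
  fixes y z :: "nat \<Rightarrow> real ^ 'p"
  assumes min: "is_tv_minimizer n lam y z" and lam: "0 < lam" and k: "k \<le> n"
  shows "tv_dual lam y z k \<bullet> h
    \<le> (if 1 \<le> k \<and> k < n then norm (z k - z (Suc k) + h) - norm (z k - z (Suc k)) else 0)"
    (is "?u \<bullet> h \<le> ?D h")
proof (rule le_of_le_add_small[of "real k * (norm h)\<^sup>2 / lam"])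
  show "0 \<le> real k * (norm h)\<^sup>2 / lam" using lam by simp
next
  fix t :: real assume t: "0 < t" "t \<le> 1"
  define w where "w j = (if j \<in> {0<..k} then z j + t *\<^sub>R h else z j)" for j
  have "w \<in> {1..n} \<rightarrow>\<^sub>E UNIV"
    using is_tv_minimizerD(1)[OF min] k by (auto simp: w_def PiE_iff extensional_def)
  then have le: "tv_objective n lam y z \<le> tv_objective n lam y w" by (rule is_tv_minimizerD(2)[OF min])
  have "(\<Sum>i=1..n. (norm (y i - w i))\<^sup>2) - (\<Sum>i=1..n. (norm (y i - z i))\<^sup>2)
      = (\<Sum>i=1..n. if i \<in> {0<..k} then t\<^sup>2 * (norm h)\<^sup>2 - 2 * t * ((y i - z i) \<bullet> h) else 0)"
    unfolding sum_subtractf[symmetric]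
    by (rule sum.cong) (simp_all add: w_def power2_norm_eq_inner inner_diff inner_add inner_commute
        power2_eq_square[of t] algebra_simps)
  also have "\<dots> = (\<Sum>i\<in>{1..n} \<inter> {0<..k}. t\<^sup>2 * (norm h)\<^sup>2 - 2 * t * ((y i - z i) \<bullet> h))"
    by (rule sum.inter_restrict[symmetric]) simp
  also have "{1..n} \<inter> {0<..k} = {0<..k}" using k by auto
  also have "(\<Sum>i\<in>{0<..k}. t\<^sup>2 * (norm h)\<^sup>2 - 2 * t * ((y i - z i) \<bullet> h))
      = real k * (t\<^sup>2 * (norm h)\<^sup>2) - 2 * t * ((\<Sum>i\<in>{0<..k}. y i - z i) \<bullet> h)"
    by (simp add: sum_subtractf inner_sum_left inner_diff_left sum_distrib_left right_diff_distrib)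
  also have "\<dots> = real k * (t\<^sup>2 * (norm h)\<^sup>2) - t * lam * (?u \<bullet> h)"
    using lam by (simp add: tv_dual_def)
  finally have fit: "(\<Sum>i=1..n. (norm (y i - w i))\<^sup>2) - (\<Sum>i=1..n. (norm (y i - z i))\<^sup>2)
      = real k * (t\<^sup>2 * (norm h)\<^sup>2) - t * lam * (?u \<bullet> h)" .
  have "(\<Sum>i=1..n-1. norm (w i - w (i+1))) - (\<Sum>i=1..n-1. norm (z i - z (i+1)))
      = (\<Sum>i=1..n-1. if i = k then norm (z k - z (Suc k) + t *\<^sub>R h) - norm (z k - z (Suc k)) else 0)"
    unfolding sum_subtractf[symmetric]
    by (rule sum.cong) (auto simp: w_def algebra_simps)
  also have "\<dots> = ?D (t *\<^sub>R h)" by (auto simp: sum.delta)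
  also have "\<dots> \<le> t * ?D h"
  proof -
    let ?d = "z k - z (Suc k)"
    have "?d + t *\<^sub>R h = (1 - t) *\<^sub>R ?d + t *\<^sub>R (?d + h)" by (simp add: algebra_simps)
    then have "norm (?d + t *\<^sub>R h) \<le> (1 - t) * norm ?d + t * norm (?d + h)"
      using norm_triangle_ineq[of "(1 - t) *\<^sub>R ?d" "t *\<^sub>R (?d + h)"] t by simp
    then show ?thesis by (simp add: algebra_simps)
  qed
  finally have tv: "(\<Sum>i=1..n-1. norm (w i - w (i+1))) - (\<Sum>i=1..n-1. norm (z i - z (i+1))) \<le> t * ?D h" .
  have "lam * ((\<Sum>i=1..n-1. norm (w i - w (i+1))) - (\<Sum>i=1..n-1. norm (z i - z (i+1)))) \<le> lam * (t * ?D h)"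
    using tv lam by (intro mult_left_mono) auto
  then have "0 \<le> real k * (t\<^sup>2 * (norm h)\<^sup>2) - t * lam * (?u \<bullet> h) + lam * (t * ?D h)"
    using le fit unfolding tv_objective_def right_diff_distrib by linarith
  also have "\<dots> = (t * lam) * (?D h + t * (real k * (norm h)\<^sup>2 / lam) - ?u \<bullet> h)"
    using lam by (simp add: field_simps power2_eq_square)
  finally have "0 \<le> ?D h + t * (real k * (norm h)\<^sup>2 / lam) - ?u \<bullet> h"
    using t lam by (simp only: zero_le_mult_iff mult_pos_pos) (metis less_asym mult_pos_pos not_less)
  then show "?u \<bullet> h \<le> ?D h + t * (real k * (norm h)\<^sup>2 / lam)" by simp
qed

lemma norm_tv_dual_le_1:
  fixes y z :: "nat \<Rightarrow> real ^ 'p"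
  assumes min: "is_tv_minimizer n lam y z" and lam: "0 < lam" and k: "k \<le> n"
  shows "norm (tv_dual lam y z k) \<le> 1"
proof (rule ccontr)
  let ?u = "tv_dual lam y z k"
  assume "\<not> ?thesis"
  then have "norm ?u * 1 < norm ?u * norm ?u" by (intro mult_strict_left_mono) auto
  also have "\<dots> = ?u \<bullet> ?u" by (simp add: norm_eq_sqrt_inner)
  also have "\<dots> \<le> norm ?u"
    using norm_triangle_ineq[of "z k - z (Suc k)" ?u] norm_ge_zero[of ?u]
    by (intro order_trans[OF tv_dual_subgradient[OF assms, of ?u]]) auto
  finally show False by simp
qed

lemma eq_scaleR_of_norm_le_inner:
  fixes v d :: "'v::real_inner"
  assumes v: "norm v \<le> 1" and d: "norm d \<le> v \<bullet> d"
  shows "d = norm d *\<^sub>R v"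
proof -
  have "norm d * norm d \<le> norm d * (v \<bullet> d)" using d by (intro mult_left_mono) auto
  moreover have "(norm d)\<^sup>2 * (norm v)\<^sup>2 \<le> (norm d)\<^sup>2 * 1"
    using v by (intro mult_left_mono) (auto simp: power_le_one)
  moreover have "(norm (d - norm d *\<^sub>R v))\<^sup>2 = d \<bullet> d - 2 * (norm d * (v \<bullet> d)) + (norm d)\<^sup>2 * (v \<bullet> v)"
    unfolding power2_norm_eq_inner[of "d - norm d *\<^sub>R v"]
    by (simp add: inner_diff inner_commute algebra_simps power2_eq_square[of "norm d"])
  ultimately have "(norm (d - norm d *\<^sub>R v))\<^sup>2 \<le> 0"
    unfolding power2_norm_eq_inner[symmetric] power2_eq_square[of "norm d"] by linarith
  then show ?thesis by simp
qed

lemma tv_dual_direction: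
  fixes y z :: "nat \<Rightarrow> real ^ 'p"
  assumes min: "is_tv_minimizer n lam y z" and lam: "0 < lam" and k: "1 \<le> k" "k < n"
  shows "z k - z (Suc k) = norm (z k - z (Suc k)) *\<^sub>R tv_dual lam y z k"
proof -
  let ?u = "tv_dual lam y z k" and ?d = "z k - z (Suc k)"
  have u: "norm ?u \<le> 1" using norm_tv_dual_le_1[OF min lam] k by simp
  have "norm ?d \<le> ?u \<bullet> ?d" using tv_dual_subgradient[OF min lam, of k "- ?d"] k by (simp add: inner_diff)
  then show ?thesis by (rule eq_scaleR_of_norm_le_inner[OF u])
qed

text \<open>
  Compare the minimizer with the midpoint of \<open>z\<close> and \<open>w\<close>: the total variation is convex, and the
  parallelogram law puts the quadratic part below the average by a quarter of the squared distance.
\<close>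

lemma tv_objective_strongly_convex:
  fixes y z w :: "nat \<Rightarrow> real ^ 'p"
  assumes min: "is_tv_minimizer n lam y z" and lam: "0 < lam" and w: "w \<in> {1..n} \<rightarrow>\<^sub>E UNIV"
  shows "(\<Sum>i=1..n. (norm (z i - w i))\<^sup>2) \<le> 2 * (tv_objective n lam y w - tv_objective n lam y z)"
proof -
  define v where "v = restrict (\<lambda>i. (1 / 2) *\<^sub>R (z i + w i)) {1..n}"
  have "tv_objective n lam y z \<le> tv_objective n lam y v"
    by (rule is_tv_minimizerD(2)[OF min]) (simp add: v_def)
  also have "\<dots> \<le> (1 / 2) * tv_objective n lam y z + (1 / 2) * tv_objective n lam y w
      - (1 / 4) * (\<Sum>i=1..n. (norm (z i - w i))\<^sup>2)"
  proof -
    have "(\<Sum>i=1..n. (norm (y i - v i))\<^sup>2) = (\<Sum>i=1..n. (1 / 2) * (norm (y i - z i))\<^sup>2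
        + (1 / 2) * (norm (y i - w i))\<^sup>2 - (1 / 4) * (norm (z i - w i))\<^sup>2)"
      by (rule sum.cong) (simp_all add: v_def power2_norm_eq_inner inner_diff inner_add inner_commute
          algebra_simps)
    moreover have "(\<Sum>i=1..n-1. norm (v i - v (i+1)))
        \<le> (\<Sum>i=1..n-1. (1 / 2) * norm (z i - z (i+1)) + (1 / 2) * norm (w i - w (i+1)))"
    proof (rule sum_mono)
      fix i assume "i \<in> {1..n-1}"
      then have "v i - v (i+1) = (1 / 2) *\<^sub>R (z i - z (i+1)) + (1 / 2) *\<^sub>R (w i - w (i+1))"
        by (auto simp: v_def algebra_simps)
      then show "norm (v i - v (i+1)) \<le> (1 / 2) * norm (z i - z (i+1)) + (1 / 2) * norm (w i - w (i+1))"
        using norm_triangle_ineq[of "(1 / 2) *\<^sub>R (z i - z (i+1))" "(1 / 2) *\<^sub>R (w i - w (i+1))"] by simp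
    qed
    then have "lam * (\<Sum>i=1..n-1. norm (v i - v (i+1)))
        \<le> lam * (\<Sum>i=1..n-1. (1 / 2) * norm (z i - z (i+1)) + (1 / 2) * norm (w i - w (i+1)))"
      using lam by (intro mult_left_mono) auto
    ultimately show ?thesis
      unfolding tv_objective_def
      by (simp add: sum.distrib sum_subtractf sum_distrib_left[symmetric] sum_divide_distrib[symmetric] algebra_simps)
  qed
  finally show ?thesis by simp
qed

lemma tv_minimizer_stable:
  fixes y y' z z' :: "nat \<Rightarrow> real ^ 'p"
  assumes min: "is_tv_minimizer n lam y z" and min': "is_tv_minimizer n lam y' z'" and lam: "0 < lam"
  shows "(\<Sum>i=1..n. (norm (z i - z' i))\<^sup>2) \<le> 4 * (\<Sum>i=1..n. (norm (y i - y' i))\<^sup>2)"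
proof -
  have 1: "(\<Sum>i=1..n. (norm (z i - z' i))\<^sup>2) \<le> 2 * (tv_objective n lam y z' - tv_objective n lam y z)"
    by (rule tv_objective_strongly_convex[OF min lam is_tv_minimizerD(1)[OF min']])
  have 2: "(\<Sum>i=1..n. (norm (z' i - z i))\<^sup>2) \<le> 2 * (tv_objective n lam y' z - tv_objective n lam y' z')"
    by (rule tv_objective_strongly_convex[OF min' lam is_tv_minimizerD(1)[OF min]])
  have "tv_objective n lam y z' - tv_objective n lam y z + (tv_objective n lam y' z - tv_objective n lam y' z')
      = (\<Sum>i=1..n. (norm (y i - z' i))\<^sup>2 - (norm (y i - z i))\<^sup>2
          + ((norm (y' i - z i))\<^sup>2 - (norm (y' i - z' i))\<^sup>2))"
    unfolding tv_objective_def by (simp add: sum_subtractf sum.distrib)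
  also have "\<dots> = (\<Sum>i=1..n. 2 * ((y i - y' i) \<bullet> (z i - z' i)))"
    by (rule sum.cong) (simp_all add: power2_norm_eq_inner inner_diff inner_commute algebra_simps)
  also have "\<dots> \<le> (\<Sum>i=1..n. 2 * (norm (y i - y' i))\<^sup>2 + (1 / 2) * (norm (z i - z' i))\<^sup>2)"
  proof (rule sum_mono)
    fix i
    have "0 \<le> (norm (2 *\<^sub>R (y i - y' i) - (z i - z' i)))\<^sup>2" by simp
    also have "\<dots> = 4 * (norm (y i - y' i))\<^sup>2 - 4 * ((y i - y' i) \<bullet> (z i - z' i)) + (norm (z i - z' i))\<^sup>2"
      unfolding power2_norm_eq_inner by (simp add: inner_diff inner_commute algebra_simps)
    finally show "2 * ((y i - y' i) \<bullet> (z i - z' i)) \<le> 2 * (norm (y i - y' i))\<^sup>2 + (1 / 2) * (norm (z i - z' i))\<^sup>2"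
      by simp
  qed
  also have "\<dots> = 2 * (\<Sum>i=1..n. (norm (y i - y' i))\<^sup>2) + (1 / 2) * (\<Sum>i=1..n. (norm (z i - z' i))\<^sup>2)"
    by (simp add: sum.distrib sum_distrib_left)
  finally show ?thesis using 1 2 by (simp add: norm_minus_commute)
qed

text \<open>
  The minimizers are given only for the data that occur, so they define a function \<open>G\<close> on the range of the data
  process \<open>Y\<close> inside the space of sequences, a set that need not be measurable.  By stability \<open>G\<close> is
  well defined and continuous on this range, hence the preimage of an open set under \<open>G\<close> is the trace of an
  open set of sequences, and only the latter is pulled back along \<open>Y\<close>.
\<close>

lemma tv_minimizer_borel_measurable:
  fixes y :: "nat \<Rightarrow> 'a \<Rightarrow> real ^ 'p" and xhat :: "'a \<Rightarrow> nat \<Rightarrow> real ^ 'p"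
  assumes lam: "0 < lam"
    and y: "\<And>j. j \<in> {1..n} \<Longrightarrow> y j \<in> borel_measurable M"
    and min: "\<And>\<omega>. \<omega> \<in> space M \<Longrightarrow> is_tv_minimizer n lam (\<lambda>j. y j \<omega>) (xhat \<omega>)"
    and i: "i \<in> {1..n}"
  shows "(\<lambda>\<omega>. xhat \<omega> i) \<in> borel_measurable M"
proof -
  define Y where "Y \<omega> = (\<lambda>j. if j \<in> {1..n} then y j \<omega> else 0)" for \<omega>
  define G where "G s = xhat (SOME \<omega>. \<omega> \<in> space M \<and> Y \<omega> = s) i" for s
  have stable: "norm (xhat \<omega> i - xhat \<omega>' i) \<le> sqrt (4 * (\<Sum>j=1..n. (norm (Y \<omega> j - Y \<omega>' j))\<^sup>2))"
    if "\<omega> \<in> space M" "\<omega>' \<in> space M" for \<omega> \<omega>'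
  proof (rule real_le_rsqrt)
    have "(norm (xhat \<omega> i - xhat \<omega>' i))\<^sup>2 \<le> (\<Sum>j=1..n. (norm (xhat \<omega> j - xhat \<omega>' j))\<^sup>2)"
      using i by (intro member_le_sum) auto
    also have "\<dots> \<le> 4 * (\<Sum>j=1..n. (norm (y j \<omega> - y j \<omega>'))\<^sup>2)"
      by (rule tv_minimizer_stable[OF min[OF that(1)] min[OF that(2)] lam])
    also have "(\<Sum>j=1..n. (norm (y j \<omega> - y j \<omega>'))\<^sup>2) = (\<Sum>j=1..n. (norm (Y \<omega> j - Y \<omega>' j))\<^sup>2)"
      by (rule sum.cong) (auto simp: Y_def)
    finally show "(norm (xhat \<omega> i - xhat \<omega>' i))\<^sup>2 \<le> 4 * (\<Sum>j=1..n. (norm (Y \<omega> j - Y \<omega>' j))\<^sup>2)" .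
  qed
  have pick: "(SOME \<omega>'. \<omega>' \<in> space M \<and> Y \<omega>' = Y \<omega>) \<in> space M"
    "Y (SOME \<omega>'. \<omega>' \<in> space M \<and> Y \<omega>' = Y \<omega>) = Y \<omega>" if "\<omega> \<in> space M" for \<omega>
    using someI[of "\<lambda>\<omega>'. \<omega>' \<in> space M \<and> Y \<omega>' = Y \<omega>" \<omega>] that by auto
  have GY: "xhat \<omega> i = G (Y \<omega>)" if "\<omega> \<in> space M" for \<omega>
    using stable[OF that pick(1)[OF that]] unfolding G_def pick(2)[OF that] by simp
  have cont: "continuous_on (Y ` space M) G"
    unfolding continuous_on_def
  proof
    fix s0 assume s0: "s0 \<in> Y ` space M"
    let ?b = "\<lambda>s. sqrt (4 * (\<Sum>j=1..n. (norm (s j - s0 j))\<^sup>2))"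
    have "((\<lambda>s. s j) \<longlongrightarrow> s0 j) (at s0 within Y ` space M)" for j
    proof -
      have "continuous_on (Y ` space M) (\<lambda>s. s j)"
        by (rule continuous_on_subset[OF continuous_on_product_coordinates]) simp
      then show ?thesis using s0 unfolding continuous_on_def by blast
    qed
    then have "(?b \<longlongrightarrow> sqrt (4 * (\<Sum>j=1..n. (norm (s0 j - s0 j))\<^sup>2))) (at s0 within Y ` space M)"
      by (intro tendsto_intros)
    then have "(?b \<longlongrightarrow> 0) (at s0 within Y ` space M)" by simp
    moreover have "\<forall>\<^sub>F s in at s0 within Y ` space M. norm (G s - G s0) \<le> ?b s"
      unfolding eventually_at_filter
    proof (rule always_eventually, intro allI impI)
      fix s assume "s \<in> Y ` space M"
      then show "norm (G s - G s0) \<le> ?b s" using s0 stable by (auto simp: GY[symmetric])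
    qed
    ultimately have "((\<lambda>s. G s - G s0) \<longlongrightarrow> 0) (at s0 within Y ` space M)"
      by (rule Lim_null_comparison[rotated])
    then show "(G \<longlongrightarrow> G s0) (at s0 within Y ` space M)" by (simp add: LIM_zero_iff)
  qed
  have Y: "Y \<in> borel_measurable M"
  proof (rule measurable_coordinatewise_then_product)
    show "(\<lambda>\<omega>. Y \<omega> j) \<in> borel_measurable M" for j
      using y[of j] by (cases "j \<in> {1..n}") (auto simp: Y_def)
  qed
  show ?thesis
  proof (rule borel_measurableI)
    fix T :: "(real ^ 'p) set" assume "open T"
    then obtain U where U: "open U" "Y ` space M \<inter> G -` T = Y ` space M \<inter> U"
      using continuous_openin_preimage_gen[OF cont] unfolding openin_open by metis
    have "(\<lambda>\<omega>. xhat \<omega> i) -` T \<inter> space M = Y -` U \<inter> space M"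
      using U(2) GY by (auto simp: set_eq_iff)
    also have "\<dots> \<in> sets M" using Y U(1) by (simp add: measurable_sets)
    finally show "(\<lambda>\<omega>. xhat \<omega> i) -` T \<inter> space M \<in> sets M" .
  qed
qed

text \<open>
  Differences of the dual vectors are window sums of \<open>z - y\<close>; subtracting them from window sums of \<open>z - c\<close>
  leaves the window sums of the noise.
\<close>

lemma tv_flow_on_piece:
  fixes x y z :: "nat \<Rightarrow> real ^ 'p"
  assumes min: "is_tv_minimizer n lam y z" and lam: "0 < lam" and qm: "q + m \<le> n"
    and const: "\<And>j. q < j \<Longrightarrow> j \<le> q + m \<Longrightarrow> x j = c"
    and noise: "\<And>a b. a < b \<Longrightarrow> b \<le> n \<Longrightarrow> norm (\<Sum>j\<in>{a<..b}. y j - x j) \<le> C * sqrt (real (b - a))"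
  shows "tv_flow m lam C (\<lambda>j. z (q + j) - c) (\<lambda>j. tv_dual lam y z (q + j))"
  unfolding tv_flow_def
proof (intro conjI allI impI ballI)
  fix j assume "j \<le> m" then show "norm (tv_dual lam y z (q + j)) \<le> 1"
    using norm_tv_dual_le_1[OF min lam, of "q + j"] qm by simp
next
  fix j assume "j \<in> {1..<m}"
  then show "z (q + j) - c - (z (q + Suc j) - c)
      = norm (z (q + j) - c - (z (q + Suc j) - c)) *\<^sub>R tv_dual lam y z (q + j)"
    using tv_dual_direction[OF min lam, of "q + j"] qm by simp
next
  fix a b assume ab: "a \<le> b" "b \<le> m"
  show "norm ((\<Sum>j\<in>{a<..b}. z (q + j) - c)
      - (lam / 2) *\<^sub>R (tv_dual lam y z (q + a) - tv_dual lam y z (q + b))) \<le> C * sqrt (real (b - a))"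
  proof (cases "a = b")
    case False
    have "{0<..q + b} = {0<..q + a} \<union> {q + a<..q + b}" using ab by auto
    then have split: "(\<Sum>j\<in>{0<..q + b}. y j - z j)
        = (\<Sum>j\<in>{0<..q + a}. y j - z j) + (\<Sum>j\<in>{q + a<..q + b}. y j - z j)"
      by (simp only:) (rule sum.union_disjoint, auto)
    have "(lam / 2) *\<^sub>R (tv_dual lam y z (q + a) - tv_dual lam y z (q + b))
        = - (\<Sum>j\<in>{q + a<..q + b}. y j - z j)"
      unfolding tv_dual_def split using lam by (simp add: algebra_simps)
    moreover have "(\<Sum>j\<in>{a<..b}. z (q + j) - c) = (\<Sum>j\<in>{q + a<..q + b}. z j - x j)"
      by (rule sum.reindex_bij_witness[of _ "\<lambda>j. j - q" "\<lambda>j. q + j"]) (use const ab in auto)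
    ultimately have "(\<Sum>j\<in>{a<..b}. z (q + j) - c)
        - (lam / 2) *\<^sub>R (tv_dual lam y z (q + a) - tv_dual lam y z (q + b))
        = (\<Sum>j\<in>{q + a<..q + b}. y j - x j)"
      by (simp add: sum_subtractf)
    then show ?thesis using noise[of "q + a" "q + b"] ab False qm by simp
  qed simp
qed

section \<open>Partial sums of Gaussian noise\<close>

lemma nn_integral_lborel_affine:
  fixes f :: "'a::euclidean_space \<Rightarrow> ennreal"
  assumes [measurable]: "f \<in> borel_measurable borel" and c: "c \<noteq> 0"
  shows "(\<integral>\<^sup>+v. f v \<partial>lborel) = ennreal (\<bar>c\<bar> ^ DIM('a)) * (\<integral>\<^sup>+v. f (t + c *\<^sub>R v) \<partial>lborel)"
  by (subst lborel_affine[OF c, of t])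
     (simp add: nn_integral_density nn_integral_distr nn_integral_cmult ennreal_power)

lemma borel_measurable_isotropic_normal_density [measurable]:
  "isotropic_normal_density \<mu> \<sigma> \<in> borel_measurable borel"
  unfolding isotropic_normal_density_def by measurable

lemma isotropic_normal_density_nonneg [simp]: "0 \<le> isotropic_normal_density \<mu> \<sigma> v"
  by (simp add: isotropic_normal_density_def)

text \<open>
  Completing the square reduces this to translation invariance.  The total mass \<open>1\<close>
  will come from the density belonging to a random variable.
\<close>

lemma isotropic_normal_mgf:
  fixes a :: "real ^ 'p"
  assumes \<sigma>: "0 < \<sigma>"
    and total: "(\<integral>\<^sup>+v. isotropic_normal_density (0 :: real ^ 'p) \<sigma> v \<partial>lborel) = 1"
  shows "(\<integral>\<^sup>+v. isotropic_normal_density 0 \<sigma> v * exp (a \<bullet> v) \<partial>lborel) = exp (\<sigma>\<^sup>2 * (norm a)\<^sup>2 / 2)"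
proof -
  let ?\<phi> = "isotropic_normal_density (0 :: real ^ 'p) \<sigma>"
  have "?\<phi> v * exp (a \<bullet> v) = exp (\<sigma>\<^sup>2 * (norm a)\<^sup>2 / 2) * ?\<phi> (- (\<sigma>\<^sup>2 *\<^sub>R a) + 1 *\<^sub>R v)" for v
  proof -
    have "(norm (v - \<sigma>\<^sup>2 *\<^sub>R a))\<^sup>2 = (norm v)\<^sup>2 - 2 * \<sigma>\<^sup>2 * (a \<bullet> v) + \<sigma>\<^sup>2 * \<sigma>\<^sup>2 * (norm a)\<^sup>2"
      unfolding power2_norm_eq_inner by (simp add: inner_diff inner_commute algebra_simps)
    then have "- (norm v)\<^sup>2 / (2 * \<sigma>\<^sup>2) + a \<bullet> v
        = \<sigma>\<^sup>2 * (norm a)\<^sup>2 / 2 + - (norm (v - \<sigma>\<^sup>2 *\<^sub>R a))\<^sup>2 / (2 * \<sigma>\<^sup>2)"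
      using \<sigma> by (simp add: field_simps power2_eq_square)
    then have "exp (- (norm v)\<^sup>2 / (2 * \<sigma>\<^sup>2)) * exp (a \<bullet> v)
        = exp (\<sigma>\<^sup>2 * (norm a)\<^sup>2 / 2) * exp (- (norm (v - \<sigma>\<^sup>2 *\<^sub>R a))\<^sup>2 / (2 * \<sigma>\<^sup>2))"
      by (simp only: exp_add[symmetric])
    then show ?thesis by (simp add: isotropic_normal_density_def)
  qed
  then have "(\<integral>\<^sup>+v. ennreal (?\<phi> v * exp (a \<bullet> v)) \<partial>lborel)
      = (\<integral>\<^sup>+v. ennreal (exp (\<sigma>\<^sup>2 * (norm a)\<^sup>2 / 2)) * ennreal (?\<phi> (- (\<sigma>\<^sup>2 *\<^sub>R a) + 1 *\<^sub>R v)) \<partial>lborel)"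
    by (simp only: ennreal_mult'' isotropic_normal_density_nonneg)
  also have "\<dots> = exp (\<sigma>\<^sup>2 * (norm a)\<^sup>2 / 2) * (\<integral>\<^sup>+v. ?\<phi> (- (\<sigma>\<^sup>2 *\<^sub>R a) + 1 *\<^sub>R v) \<partial>lborel)"
    by (rule nn_integral_cmult) measurable
  also have "(\<integral>\<^sup>+v. ?\<phi> (- (\<sigma>\<^sup>2 *\<^sub>R a) + 1 *\<^sub>R v) \<partial>lborel) = 1"
    using nn_integral_lborel_affine[of "\<lambda>v. ennreal (?\<phi> v)" 1 "- (\<sigma>\<^sup>2 *\<^sub>R a)"] total by simp
  finally show ?thesis by simp
qed

text \<open>
  The exponent \<open>3 / (8 \<sigma>\<^sup>2)\<close> turns the variance \<open>\<sigma>\<^sup>2\<close> into \<open>4 \<sigma>\<^sup>2\<close>, that is, it replaces the density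
  at \<open>v\<close> by the density at \<open>v / 2\<close>.
\<close>

lemma isotropic_normal_square_mgf:
  assumes \<sigma>: "0 < \<sigma>"
    and total: "(\<integral>\<^sup>+v. isotropic_normal_density (0 :: real ^ 'p) \<sigma> v \<partial>lborel) = 1"
  shows "(\<integral>\<^sup>+v. isotropic_normal_density (0 :: real ^ 'p) \<sigma> v * exp (3 / (8 * \<sigma>\<^sup>2) * (norm v)\<^sup>2) \<partial>lborel)
    = 2 ^ CARD('p)"
proof -
  let ?\<phi> = "isotropic_normal_density (0 :: real ^ 'p) \<sigma>"
  have "?\<phi> v * exp (3 / (8 * \<sigma>\<^sup>2) * (norm v)\<^sup>2) = ?\<phi> (0 + (1 / 2) *\<^sub>R v)" for v
  proof -
    have "- (norm v)\<^sup>2 / (2 * \<sigma>\<^sup>2) + 3 / (8 * \<sigma>\<^sup>2) * (norm v)\<^sup>2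
        = - (norm ((1 / 2) *\<^sub>R v))\<^sup>2 / (2 * \<sigma>\<^sup>2)"
      using \<sigma> by (simp add: power_divide field_simps)
    then show ?thesis by (simp add: isotropic_normal_density_def mult_exp_exp)
  qed
  then have "(\<integral>\<^sup>+v. ?\<phi> v * exp (3 / (8 * \<sigma>\<^sup>2) * (norm v)\<^sup>2) \<partial>lborel)
      = (\<integral>\<^sup>+v. ?\<phi> (0 + (1 / 2) *\<^sub>R v) \<partial>lborel)" by simp
  also have "\<dots> = ennreal (2 ^ CARD('p)) * (ennreal ((1 / 2) ^ CARD('p)) * (\<integral>\<^sup>+v. ?\<phi> (0 + (1 / 2) *\<^sub>R v) \<partial>lborel))"
    by (simp add: mult.assoc[symmetric] ennreal_mult[symmetric] power_mult_distrib[symmetric])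
  also have "\<dots> = 2 ^ CARD('p)"
    using nn_integral_lborel_affine[of "\<lambda>v. ennreal (?\<phi> v)" "1 / 2" 0] total by (simp add: ennreal_power[symmetric])
  finally show ?thesis .
qed

text \<open>
  The square is linearised: \<open>exp (s \<parallel>w\<parallel>\<^sup>2)\<close> is the average of \<open>exp (\<kappa> w \<bullet> v)\<close> over a normal vector \<open>v\<close>.
  After exchanging the integrals, independence factors the exponential of the sum, and each factor is a moment
  generating function.  The distribution of the sum itself never has to be determined.
\<close>

lemma (in prob_space) isotropic_normal_sum_square_mgf:
  fixes eps :: "'i \<Rightarrow> 'a \<Rightarrow> real ^ 'p"
  assumes \<sigma>: "0 < \<sigma>" and I: "finite I" "I \<noteq> {}"
    and indep: "indep_vars (\<lambda>_. borel) eps I"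
    and dist: "\<And>i. i \<in> I \<Longrightarrow> distributed M lborel (eps i) (isotropic_normal_density 0 \<sigma>)"
  shows "(\<integral>\<^sup>+\<omega>. exp (3 / (8 * \<sigma>\<^sup>2 * real (card I)) * (norm (\<Sum>i\<in>I. eps i \<omega>))\<^sup>2) \<partial>M) = 2 ^ CARD('p)"
proof -
  let ?\<phi> = "isotropic_normal_density (0 :: real ^ 'p) \<sigma>"
  define L where "L = real (card I)"
  have L: "0 < L" using I by (simp add: L_def card_gt_0_iff)
  define s where "s = 3 / (8 * \<sigma>\<^sup>2 * L)"
  define \<kappa> where "\<kappa> = sqrt (2 * s) / \<sigma>"
  have s: "0 \<le> s" using L by (simp add: s_def)
  have \<kappa>: "\<sigma>\<^sup>2 * (norm (\<kappa> *\<^sub>R w))\<^sup>2 / 2 = s * (norm w)\<^sup>2" for w :: "real ^ 'p"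
    using \<sigma> s by (simp add: \<kappa>_def power_mult_distrib power_divide)
  have [measurable]: "eps i \<in> borel_measurable M" if "i \<in> I" for i
    using distributed_measurable[OF dist[OF that]] by simp
  have total: "(\<integral>\<^sup>+v. ?\<phi> v \<partial>lborel) = 1"
  proof -
    obtain i where "i \<in> I" using I by auto
    then show ?thesis
      using distributed_nn_integral[OF dist, of i "\<lambda>_. 1"] emeasure_space_1 by simp
  qed
  let ?S = "\<lambda>\<omega>. \<Sum>i\<in>I. eps i \<omega>"
  interpret P: pair_sigma_finite M "lborel :: (real ^ 'p) measure"
    by (intro pair_sigma_finite.intro sigma_finite_measure_axioms lborel.sigma_finite_measure_axioms)
  have "(\<integral>\<^sup>+\<omega>. exp (s * (norm (?S \<omega>))\<^sup>2) \<partial>M)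
      = (\<integral>\<^sup>+\<omega>. (\<integral>\<^sup>+v. ?\<phi> v * exp ((\<kappa> *\<^sub>R ?S \<omega>) \<bullet> v) \<partial>lborel) \<partial>M)"
    by (subst isotropic_normal_mgf[OF \<sigma> total]) (simp only: \<kappa>)
  also have "\<dots> = (\<integral>\<^sup>+v. (\<integral>\<^sup>+\<omega>. ?\<phi> v * exp ((\<kappa> *\<^sub>R ?S \<omega>) \<bullet> v) \<partial>M) \<partial>lborel)"
    by (rule P.Fubini'[symmetric]) measurable
  also have "\<dots> = (\<integral>\<^sup>+v. ?\<phi> v * exp (3 / (8 * \<sigma>\<^sup>2) * (norm v)\<^sup>2) \<partial>lborel)"
  proof (rule nn_integral_cong)
    fix v :: "real ^ 'p"
    have "(\<integral>\<^sup>+\<omega>. exp ((\<kappa> *\<^sub>R ?S \<omega>) \<bullet> v) \<partial>M) = (\<integral>\<^sup>+\<omega>. (\<Prod>i\<in>I. ennreal (exp ((\<kappa> *\<^sub>R v) \<bullet> eps i \<omega>))) \<partial>M)"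
      by (simp add: inner_commute[of _ v] inner_sum_right sum_distrib_left exp_sum[OF I(1)] prod_ennreal)
    also have "\<dots> = (\<Prod>i\<in>I. \<integral>\<^sup>+\<omega>. ennreal (exp ((\<kappa> *\<^sub>R v) \<bullet> eps i \<omega>)) \<partial>M)"
      by (intro indep_vars_nn_integral[OF I(1)] zero_le
          indep_vars_compose2[OF indep, where Y = "\<lambda>_ w. ennreal (exp ((\<kappa> *\<^sub>R v) \<bullet> w))"]) measurable
    also have "\<dots> = (\<Prod>i\<in>I. ennreal (exp (s * (norm v)\<^sup>2)))"
    proof (rule prod.cong)
      fix i assume "i \<in> I"
      have "(\<integral>\<^sup>+\<omega>. ennreal (exp ((\<kappa> *\<^sub>R v) \<bullet> eps i \<omega>)) \<partial>M)
          = (\<integral>\<^sup>+w. ennreal (?\<phi> w) * ennreal (exp ((\<kappa> *\<^sub>R v) \<bullet> w)) \<partial>lborel)"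
        by (rule distributed_nn_integral[OF dist[OF \<open>i \<in> I\<close>], symmetric]) measurable
      also have "\<dots> = exp (s * (norm v)\<^sup>2)"
        using isotropic_normal_mgf[OF \<sigma> total, of "\<kappa> *\<^sub>R v"] \<kappa>[of v] by (simp add: ennreal_mult)
      finally show "(\<integral>\<^sup>+\<omega>. ennreal (exp ((\<kappa> *\<^sub>R v) \<bullet> eps i \<omega>)) \<partial>M) = ennreal (exp (s * (norm v)\<^sup>2))" .
    qed simp
    also have "\<dots> = exp (3 / (8 * \<sigma>\<^sup>2) * (norm v)\<^sup>2)"
    proof -
      have "L * (s * (norm v)\<^sup>2) = 3 / (8 * \<sigma>\<^sup>2) * (norm v)\<^sup>2" using L by (simp add: s_def)
      then show ?thesis by (simp add: ennreal_power exp_of_nat_mult[symmetric] L_def)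
    qed
    finally show "(\<integral>\<^sup>+\<omega>. ?\<phi> v * exp ((\<kappa> *\<^sub>R ?S \<omega>) \<bullet> v) \<partial>M) = ?\<phi> v * exp (3 / (8 * \<sigma>\<^sup>2) * (norm v)\<^sup>2)"
      by (simp add: ennreal_mult nn_integral_cmult)
  qed
  also have "\<dots> = 2 ^ CARD('p)" by (rule isotropic_normal_square_mgf[OF \<sigma> total])
  finally show ?thesis by (simp add: s_def L_def)
qed

lemma (in prob_space) isotropic_normal_sum_tail:
  fixes eps :: "'i \<Rightarrow> 'a \<Rightarrow> real ^ 'p"
  assumes \<sigma>: "0 < \<sigma>" and I: "finite I" "I \<noteq> {}"
    and indep: "indep_vars (\<lambda>_. borel) eps I"
    and dist: "\<And>i. i \<in> I \<Longrightarrow> distributed M lborel (eps i) (isotropic_normal_density 0 \<sigma>)"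
    and B: "0 \<le> B"
  shows "prob {\<omega> \<in> space M. B * sqrt (real (card I)) \<le> norm (\<Sum>i\<in>I. eps i \<omega>)}
    \<le> 2 ^ CARD('p) * exp (- (3 * B\<^sup>2 / (8 * \<sigma>\<^sup>2)))"
proof -
  define L where "L = real (card I)"
  have L: "0 < L" using I by (simp add: L_def card_gt_0_iff)
  define s where "s = 3 / (8 * \<sigma>\<^sup>2 * L)"
  have s: "0 < s" using L \<sigma> by (simp add: s_def)
  have [measurable]: "eps i \<in> borel_measurable M" if "i \<in> I" for i
    using distributed_measurable[OF dist[OF that]] by simp
  let ?N = "\<lambda>\<omega>. norm (\<Sum>i\<in>I. eps i \<omega>)"
  have "B\<^sup>2 * L \<le> x\<^sup>2" if "B * sqrt L \<le> x" for x
    using power_mono[OF that, of 2] B L by (simp add: power_mult_distrib)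
  then have "{\<omega> \<in> space M. B * sqrt L \<le> ?N \<omega>} \<subseteq> {\<omega> \<in> space M. B\<^sup>2 * L \<le> (?N \<omega>)\<^sup>2}"
    by blast
  then have "emeasure M {\<omega> \<in> space M. B * sqrt L \<le> ?N \<omega>} \<le> emeasure M {\<omega> \<in> space M. B\<^sup>2 * L \<le> (?N \<omega>)\<^sup>2}"
    by (rule emeasure_mono) measurable
  also have "\<dots> \<le> ennreal (exp (- s * (B\<^sup>2 * L)))
      * (\<integral>\<^sup>+\<omega>. ennreal (exp (s * (?N \<omega>)\<^sup>2)) * indicator (space M) \<omega> \<partial>M)"
    by (rule Chernoff_ineq_nn_integral_ge[OF s]) measurable
  also have "(\<integral>\<^sup>+\<omega>. ennreal (exp (s * (?N \<omega>)\<^sup>2)) * indicator (space M) \<omega> \<partial>M)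
      = (\<integral>\<^sup>+\<omega>. exp (s * (?N \<omega>)\<^sup>2) \<partial>M)"
    by (rule nn_integral_cong) simp
  also have "\<dots> = 2 ^ CARD('p)"
    using isotropic_normal_sum_square_mgf[OF \<sigma> I indep dist] by (simp add: s_def L_def)
  also have "- s * (B\<^sup>2 * L) = - (3 * B\<^sup>2 / (8 * \<sigma>\<^sup>2))" using L by (simp add: s_def)
  also have "ennreal (exp (- (3 * B\<^sup>2 / (8 * \<sigma>\<^sup>2)))) * 2 ^ CARD('p)
      = ennreal (2 ^ CARD('p) * exp (- (3 * B\<^sup>2 / (8 * \<sigma>\<^sup>2))))"
    by (simp add: ennreal_mult ennreal_power[symmetric] mult.commute)
  finally show ?thesis by (simp add: emeasure_eq_measure L_def)
qed

text \<open>
  With \<open>q = (noise_level / \<sigma>)\<^sup>2\<close> and \<open>\<Lambda> = ln (n t)\<close>, the two entries of the maximum give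
  \<open>q \<ge> 8 \<Lambda> + p\<close> and \<open>q \<ge> 4 p\<close>.  Weighting them by \<open>2 / 3\<close> and \<open>1 / 3\<close> yields
  \<open>3 q / 8 \<ge> 2 \<Lambda> + 3 p / 4\<close>, and \<open>ln 2 < 3 / 4\<close>.
\<close>

lemma noise_level_tail:
  fixes \<sigma> t :: real and n p :: nat
  assumes \<sigma>: "0 < \<sigma>" and t: "1 \<le> t" and n: "1 \<le> n"
  shows "2 ^ p * exp (- (3 * (noise_level \<sigma> n t p)\<^sup>2 / (8 * \<sigma>\<^sup>2))) \<le> 1 / (real n * t)\<^sup>2"
proof -
  define \<Lambda> where "\<Lambda> = ln (real n) + ln t"
  define q where "q = (noise_level \<sigma> n t p)\<^sup>2 / \<sigma>\<^sup>2"
  let ?m = "max (sqrt (8 * \<Lambda> + real p)) (2 * sqrt (real p))"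
  have q: "q = ?m\<^sup>2" using \<sigma> by (simp add: q_def noise_level_def \<Lambda>_def power_mult_distrib)
  have \<Lambda>: "0 \<le> \<Lambda>" using t n by (simp add: \<Lambda>_def)
  have "(sqrt (8 * \<Lambda> + real p))\<^sup>2 \<le> ?m\<^sup>2" using \<Lambda> by (intro power_mono) auto
  then have q1: "8 * \<Lambda> + real p \<le> q" using q \<Lambda> by simp
  have "(2 * sqrt (real p))\<^sup>2 \<le> ?m\<^sup>2" by (intro power_mono) auto
  then have q2: "4 * real p \<le> q" using q by (simp add: power_mult_distrib)
  have "2 ^ p = exp (real p * ln 2)" by (simp add: exp_of_nat_mult)
  then have "2 ^ p * exp (- (3 * (noise_level \<sigma> n t p)\<^sup>2 / (8 * \<sigma>\<^sup>2))) = exp (real p * ln 2 - 3 / 8 * q)"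
    by (simp add: q_def exp_diff exp_minus field_simps)
  also have "\<dots> \<le> exp (- (2 * \<Lambda>))"
  proof -
    have "real p * ln 2 \<le> real p * (3 / 4)" using ln2_le_25_over_36 by (intro mult_left_mono) auto
    then have "real p * ln 2 - 3 / 8 * q \<le> - (2 * \<Lambda>)" using q1 q2 by linarith
    then show ?thesis by simp
  qed
  also have "\<dots> = 1 / (exp \<Lambda>)\<^sup>2"
    by (simp add: exp_minus exp_double field_simps power2_eq_square flip: exp_add)
  also have "exp \<Lambda> = real n * t" using t n by (simp add: \<Lambda>_def exp_add)
  finally show ?thesis .
qed

text \<open>
  Each window fails with probability at most \<open>1 / (n t)\<^sup>2\<close>, and there are at most \<open>n\<^sup>2\<close> windows.
\<close>

lemma (in prob_space) noise_partial_sums: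
  fixes eps :: "nat \<Rightarrow> 'a \<Rightarrow> real ^ 'p"
  assumes \<sigma>: "0 < \<sigma>" and t: "1 \<le> t" and n: "1 \<le> n"
    and indep: "indep_vars (\<lambda>_. borel) eps {1..n}"
    and dist: "\<And>i. i \<in> {1..n} \<Longrightarrow> distributed M lborel (eps i) (isotropic_normal_density 0 \<sigma>)"
  defines "My \<equiv> noise_level \<sigma> n t CARD('p)"
  obtains G where "G \<in> events" "1 - 1 / t\<^sup>2 \<le> prob G"
    "\<And>\<omega> a b. \<omega> \<in> G \<Longrightarrow> a < b \<Longrightarrow> b \<le> n \<Longrightarrow>
      norm (\<Sum>j\<in>{a<..b}. eps j \<omega>) \<le> My * sqrt (real (b - a))"
proof -
  have My: "0 \<le> My" using \<sigma> unfolding My_def noise_level_def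
    by (intro mult_nonneg_nonneg) (auto simp: le_max_iff_disj)
  have meas [measurable]: "eps j \<in> borel_measurable M" if "j \<in> {1..n}" for j
    using distributed_measurable[OF dist[OF that]] by simp
  let ?P = "{(a, b). a < b \<and> b \<le> n}"
  define bad where "bad ab = {\<omega> \<in> space M. My * sqrt (real (card {fst ab<..snd ab}))
      \<le> norm (\<Sum>j\<in>{fst ab<..snd ab}. eps j \<omega>)}" for ab
  have sub: "?P \<subseteq> {0..<n} \<times> {1..n}" by auto
  have fin: "finite ?P" by (rule finite_subset[OF sub]) simp
  have card: "card ?P \<le> n * n"
    using card_mono[OF _ sub] by (simp add: card_cartesian_product)
  have ev: "bad ab \<in> events" if "ab \<in> ?P" for ab
  proof -
    have [measurable]: "eps j \<in> borel_measurable M" if "j \<in> {fst ab<..snd ab}" for j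
      using that \<open>ab \<in> ?P\<close> by (intro meas) auto
    show ?thesis unfolding bad_def by measurable
  qed
  have tail: "prob (bad ab) \<le> 1 / (real n * t)\<^sup>2" if ab: "ab \<in> ?P" for ab
  proof -
    let ?I = "{fst ab<..snd ab}"
    have sub: "?I \<subseteq> {1..n}" "?I \<noteq> {}" using ab by auto
    have "prob (bad ab) \<le> 2 ^ CARD('p) * exp (- (3 * My\<^sup>2 / (8 * \<sigma>\<^sup>2)))"
      unfolding bad_def
      by (rule isotropic_normal_sum_tail[OF \<sigma> _ sub(2) indep_vars_subset[OF indep sub(1)] dist My])
        (use sub in auto)
    also have "\<dots> \<le> 1 / (real n * t)\<^sup>2" unfolding My_def by (rule noise_level_tail[OF \<sigma> t n])
    finally show ?thesis .
  qed
  have "prob (\<Union>ab\<in>?P. bad ab) \<le> (\<Sum>ab\<in>?P. prob (bad ab))"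
    by (rule finite_measure_subadditive_finite[OF fin]) (use ev in auto)
  also have "\<dots> \<le> real (card ?P) * (1 / (real n * t)\<^sup>2)" using tail by (intro sum_bounded_above)
  also have "\<dots> \<le> real (n * n) * (1 / (real n * t)\<^sup>2)" using card by (intro mult_right_mono of_nat_mono) auto
  also have "\<dots> = 1 / t\<^sup>2" using n by (simp add: power2_eq_square)
  finally have le: "prob (\<Union>ab\<in>?P. bad ab) \<le> 1 / t\<^sup>2" .
  have U: "(\<Union>ab\<in>?P. bad ab) \<in> events" using fin ev by (intro sets.finite_UN) auto
  show ?thesis
  proof (rule that[of "space M - (\<Union>ab\<in>?P. bad ab)"])
    show "1 - 1 / t\<^sup>2 \<le> prob (space M - (\<Union>ab\<in>?P. bad ab))" using prob_compl[OF U] le by simp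
    fix \<omega> a b assume \<omega>: "\<omega> \<in> space M - (\<Union>ab\<in>?P. bad ab)" "a < b" "b \<le> n"
    then have "\<omega> \<notin> bad (a, b)" "\<omega> \<in> space M" by auto
    then have "\<not> My * sqrt (real (b - a)) \<le> norm (\<Sum>j\<in>{a<..b}. eps j \<omega>)"
      unfolding bad_def by simp
    then show "norm (\<Sum>j\<in>{a<..b}. eps j \<omega>) \<le> My * sqrt (real (b - a))" by linarith
  qed (use U in auto)
qed

section \<open>Pieces of the signal and the error bound\<close>

lemma breakpoints_less:
  assumes "breakpoints n K nn" "1 \<le> j" "j < k" "k \<le> K + 1"
  shows "nn j < nn k"
proof -
  have sm: "strict_mono_on {1..K} nn" and nK: "nn K < n" "nn (K + 1) = n + 1"
    using assms(1) by (auto simp: breakpoints_def)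
  show ?thesis
  proof (cases "k \<le> K")
    case True
    then show ?thesis using strict_mono_onD[OF sm] assms by auto
  next
    case False
    then have k: "k = K + 1" "j \<le> K" using assms by auto
    have "nn j \<le> nn K"
      using strict_mono_onD[OF sm, of j K] k assms(2) by (cases "j = K") auto
    then show ?thesis using nK k by simp
  qed
qed

lemma piece_of_bounds:
  assumes br: "breakpoints n K nn" and i: "i \<in> {1..n}"
  defines "k \<equiv> piece_of K nn i"
  shows "k \<in> {1..K}" "1 \<le> nn k" "nn k \<le> i" "i < nn (k + 1)" "nn (k + 1) \<le> n + 1"
proof -
  have K: "1 \<le> K" "nn 1 = 1" "nn (K + 1) = n + 1" using br by (auto simp: breakpoints_def)
  note less = breakpoints_less[OF br]
  let ?P = "\<lambda>k. k \<in> {1..K} \<and> nn k \<le> i \<and> i \<le> nn (k + 1) - 1"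
  obtain l where l: "1 \<le> l" "l \<le> K" "\<And>j. 1 \<le> j \<Longrightarrow> j \<le> l \<Longrightarrow> nn j \<le> i" "l < K \<Longrightarrow> \<not> nn (Suc l) \<le> i"
    using maximal_right_run[of "\<lambda>j. nn j \<le> i" 1 K] K i by auto
  have "?P l"
  proof (cases "l < K")
    case True
    then show ?thesis using l(1,2) l(3)[of l] l(4) by auto
  next
    case False
    then have "l = K" using l by simp
    then show ?thesis using l(1,2) l(3)[of l] K i by auto
  qed
  moreover have "j = l" if "?P j" "?P l" for j l
  proof (rule ccontr)
    assume "j \<noteq> l"
    moreover have False if P: "?P j" "?P l" "j < l" for j l
    proof -
      have "nn (j + 1) \<le> nn l" using less[of "j + 1" l] P by (cases "j + 1 = l") auto
      moreover have "nn j < nn (j + 1)" using less[of j "j + 1"] P by auto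
      ultimately show False using P by auto
    qed
    ultimately show False using that by (meson linorder_neqE_nat)
  qed
  ultimately have k: "?P k" unfolding k_def piece_of_def by (metis (mono_tags, lifting) theI)
  have "nn k < nn (k + 1)" using less[of k "k + 1"] k by auto
  then show "k \<in> {1..K}" "nn k \<le> i" "i < nn (k + 1)" using k by auto
  show "1 \<le> nn k" using less[of 1 k] k K by (cases "k = 1") auto
  show "nn (k + 1) \<le> n + 1" using less[of "k + 1" "K + 1"] k K by (cases "k = K") auto
qed

theorem theorem4p1:
  fixes M :: "'a measure"
    and n K :: nat and nn :: "nat \<Rightarrow> nat"
    and \<sigma> t lam My :: real
    and x :: "nat \<Rightarrow> real ^ 'p"
    and eps y :: "nat \<Rightarrow> 'a \<Rightarrow> real ^ 'p"
    and xhat :: "'a \<Rightarrow> nat \<Rightarrow> real ^ 'p"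
  assumes "prob_space M"
    and "\<sigma> > 0" and "t \<ge> 1"
    and "breakpoints n K nn"
    and "piecewise_constant K nn x"
    and "prob_space.indep_vars M (\<lambda>_. borel) eps {1..n}"
    and "\<And>i. i \<in> {1..n} \<Longrightarrow> distributed M lborel (eps i) (isotropic_normal_density 0 \<sigma>)"
    and "\<And>i \<omega>. i \<in> {1..n} \<Longrightarrow> \<omega> \<in> space M \<Longrightarrow> y i \<omega> = x i + eps i \<omega>"
    and "\<And>\<omega>. \<omega> \<in> space M \<Longrightarrow> is_tv_minimizer n lam (\<lambda>i. y i \<omega>) (xhat \<omega>)"
    and "My = noise_level \<sigma> n t CARD('p)"
    and "25\<^sup>2 * My \<le> lam"
    and "lam < (MIN k\<in>{1..K}. (7 * real (piece_length nn k) - sqrt (real (piece_length nn k))) * My)"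
  shows "measure M {\<omega> \<in> space M. \<forall>i\<in>{1..n}.
           norm (xhat \<omega> i - x i) \<le>
             error_bound My lam (real (piece_length nn (piece_of K nn i)))
               (real (boundary_dist K nn i))} \<ge> 1 - 1 / t\<^sup>2"
proof -
  interpret prob_space M by (rule assms(1))
  note \<sigma> = assms(2) and br = assms(4) and yx = assms(8) and min = assms(9)
  have n: "1 \<le> n" using br by (auto simp: breakpoints_def)
  have "0 < 2 * sqrt (real CARD('p))" by simp
  then have My: "0 < My" unfolding assms(10) noise_level_def using \<sigma>
    by (intro mult_pos_pos) (auto simp: less_max_iff_disj)
  have lam: "0 < lam" using My assms(11) by simp
  let ?bound = "\<lambda>i. error_bound My lam (real (piece_length nn (piece_of K nn i))) (real (boundary_dist K nn i))"
  let ?F = "{\<omega> \<in> space M. \<forall>i\<in>{1..n}. norm (xhat \<omega> i - x i) \<le> ?bound i}"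
  have y: "y j \<in> borel_measurable M" if "j \<in> {1..n}" for j
  proof -
    have "(\<lambda>\<omega>. x j + eps j \<omega>) \<in> borel_measurable M"
      using distributed_measurable[OF assms(7)[OF that]] by simp
    then show ?thesis using yx[OF that] by (simp cong: measurable_cong)
  qed
  have F: "?F \<in> events"
  proof (rule sets.sets_Collect_finite_All')
    fix i assume "i \<in> {1..n}"
    then have [measurable]: "(\<lambda>\<omega>. xhat \<omega> i) \<in> borel_measurable M"
      by (intro tv_minimizer_borel_measurable[OF lam y min]) auto
    show "{\<omega> \<in> space M. norm (xhat \<omega> i - x i) \<le> ?bound i} \<in> events" by measurable
  qed (use n in auto)
  obtain G where G: "G \<in> events" "1 - 1 / t\<^sup>2 \<le> prob G"
    and noise: "\<And>\<omega> a b. \<omega> \<in> G \<Longrightarrow> a < b \<Longrightarrow> b \<le> n \<Longrightarrow>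
      norm (\<Sum>j\<in>{a<..b}. eps j \<omega>) \<le> My * sqrt (real (b - a))"
    using noise_partial_sums[OF \<sigma> assms(3) n assms(6,7)] unfolding assms(10) by metis
  have "G \<subseteq> ?F"
  proof
    fix \<omega> assume \<omega>: "\<omega> \<in> G"
    then have \<omega>M: "\<omega> \<in> space M" using sets.sets_into_space[OF G(1)] by auto
    have "norm (xhat \<omega> i - x i) \<le> ?bound i" if i: "i \<in> {1..n}" for i
    proof -
      let ?k = "piece_of K nn i"
      note k = piece_of_bounds[OF br i]
      define q where "q = nn ?k - 1"
      define m where "m = piece_length nn ?k"
      have qm: "q + m \<le> n" "q + (i - q) = i" "1 \<le> i - q" "i - q \<le> m"
        using k by (auto simp: q_def m_def piece_length_def)
      have d: "boundary_dist K nn i = min (i - q) (m + 1 - (i - q))"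
        using k by (auto simp: boundary_dist_def q_def m_def piece_length_def)
      have const: "x j = x i" if "q < j" "j \<le> q + m" for j
      proof -
        have "x l = x (nn ?k)" if "l \<in> {nn ?k..<nn (?k + 1)}" for l
          using assms(5) k(1) that unfolding piecewise_constant_def by blast
        moreover have "j \<in> {nn ?k..<nn (?k + 1)}"
          using that k by (auto simp: q_def m_def piece_length_def)
        moreover have "i \<in> {nn ?k..<nn (?k + 1)}" using k by auto
        ultimately show ?thesis by metis
      qed
      have "tv_flow m lam My (\<lambda>j. xhat \<omega> (q + j) - x i)
          (\<lambda>j. tv_dual lam (\<lambda>j. y j \<omega>) (xhat \<omega>) (q + j))"
      proof (rule tv_flow_on_piece[OF min[OF \<omega>M] lam qm(1) const])
        fix a b assume ab: "a < b" "b \<le> n"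
        have "(\<Sum>j\<in>{a<..b}. y j \<omega> - x j) = (\<Sum>j\<in>{a<..b}. eps j \<omega>)"
          by (rule sum.cong) (use ab yx \<omega>M in auto)
        then show "norm (\<Sum>j\<in>{a<..b}. y j \<omega> - x j) \<le> My * sqrt (real (b - a))"
          using noise[OF \<omega> ab] by simp
      qed
      from tv_flow_error_bound[OF this My assms(11) qm(3,4)] show ?thesis
        unfolding qm(2) d m_def .
    qed
    then show "\<omega> \<in> ?F" using \<omega>M by simp
  qed
  then have "prob G \<le> prob ?F" by (rule finite_measure_mono[OF _ F])
  then show ?thesis using G(2) by simp
qed

end
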